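(* Let $\overline{OE}(n)$ denote the number of odd-even overpartitions of $n$. Then \[ \overline{OE}(n)\sim \frac{1}{3^{5/4}\, n^{3/4}}\, e^{\pi\sqrt{n/3}} \] as $n\to\infty$.
   Context: An overpartition of a positive integer $n$ is a partition of $n$ in which the first occurrence of a part size may be overlined. An odd-even overpartition is an overpartition whose smallest part is odd and such that the difference between successive parts is odd if the smaller of the two is non-overlined and even if it is overlined. Equivalently, $\sum_{n\ge0}\overline{OE}(n)q^n=\sum_{m\ge0}\frac{(-1;q)_m q^{m(m+1)/2}}{(q^2;q^2)_m}$ with $\overline{OE}(0)=1$, where $(a;q)_m=\prod_{j=1}^m(1-aq^{j-1})$. *)

theory Defs
  imports Complex_Main "HOL-Library.Landau_Symbols"
begin

text \<open>
  An overpartition is written as the list of its parts in nonincreasing order, each part being a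
  pair of its size and a flag that says whether it is overlined.  The last condition says that
  only the first occurrence of a size may be overlined.
\<close>

definition overpartition :: "nat \<Rightarrow> (nat \<times> bool) list \<Rightarrow> bool" where
  "overpartition n ps \<longleftrightarrow>
     sorted_wrt (\<ge>) (map fst ps) \<and>
     (\<forall>p\<in>set ps. fst p > 0) \<and>
     sum_list (map fst ps) = n \<and>
     (\<forall>i<length ps. snd (ps ! i) \<longrightarrow> (\<forall>j<i. fst (ps ! j) \<noteq> fst (ps ! i)))"

text \<open>
  Of the successive parts with indices \<open>i\<close> and \<open>Suc i\<close>, the smaller one is the one with index
  \<open>Suc i\<close>.  Two equal successive parts are thereby excluded: the second of them cannot be
  overlined, and the difference 0 is not odd.  The empty overpartition of 0 counts as odd-even.
\<close>

definition odd_even_overpartition :: "nat \<Rightarrow> (nat \<times> bool) list \<Rightarrow> bool" where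
  "odd_even_overpartition n ps \<longleftrightarrow>
     overpartition n ps \<and>
     (ps \<noteq> [] \<longrightarrow> odd (fst (last ps))) \<and>
     (\<forall>i. Suc i < length ps \<longrightarrow>
        (if snd (ps ! Suc i) then even (fst (ps ! i) - fst (ps ! Suc i))
         else odd (fst (ps ! i) - fst (ps ! Suc i))))"

definition OE :: "nat \<Rightarrow> nat" where
  "OE n = card {ps. odd_even_overpartition n ps}"

end

theory Submission
  imports Defs "HOL-Complex_Analysis.Complex_Analysis" "HOL-Probability.Probability"
    "HOL-Real_Asymp.Real_Asymp"
begin

text \<open>
  In an odd-even overpartition the parts are distinct, the smallest one is odd, and every overline
  except that of the largest part is determined by a parity. So for \<open>n > 0\<close> the count is twice the
  number of partitions of \<open>n\<close> into distinct parts with odd smallest part, that is,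
  \<open>2 * (\<Sum>k. (-1)^k * D k n)\<close> where \<open>D k n\<close> counts the partitions into distinct parts greater
  than \<open>k\<close>. From \<open>D k n = D (k + 1) n + D (k + 1) (n - k - 1)\<close> and monotonicity in \<open>n\<close> one gets
  \<open>D k n / D 0 n \<longlonglongrightarrow> 2^-k\<close>, and truncating the alternating sum gives \<open>4/3 * D 0 n\<close>.

  The asymptotics of \<open>D 0 n\<close> come from the saddle point method applied to \<open>\<Prod>j\<ge>1. 1 + q^j\<close>. Its
  logarithm at \<open>q = exp (- \<tau>)\<close> is \<open>pi\<^sup>2 / (12 * \<tau>) - ln 2 / 2 + o(1)\<close> in a cone around the positive
  axis, and away from \<open>q > 0\<close> the bound
  \<open>|1 + z| \<le> (1 + |z|) * exp (- (|z| - Re z) / 4)\<close> reduces the estimate to a geometric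
  series, with a majorant that permits dominated convergence.
\<close>

section \<open>Partitions into distinct parts\<close>

definition distinct_parts :: "nat \<Rightarrow> nat \<Rightarrow> nat set set" where
  "distinct_parts k n = {S. finite S \<and> (\<forall>x\<in>S. k < x) \<and> \<Sum>S = n}"

lemma distinct_parts_subset: "distinct_parts k n \<subseteq> Pow {Suc k..n}"
  unfolding distinct_parts_def using member_le_sum[of _ _ "\<lambda>x::nat. x"] by fastforce

lemma finite_distinct_parts [simp]: "finite (distinct_parts k n)"
  by (rule finite_subset[OF distinct_parts_subset]) simp

text \<open>Split by whether \<open>Suc k\<close> is a part, and delete it if it is. The assumption
  guards the truncated subtraction: for \<open>n < Suc k\<close> the last count would be 1, from the
  empty partition of 0.\<close>

lemma distinct_parts_rec:
  assumes "Suc k \<le> n"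
  shows "card (distinct_parts k n) = card (distinct_parts (Suc k) n) + card (distinct_parts (Suc k) (n - Suc k))"
proof -
  have "distinct_parts k n = distinct_parts (Suc k) n \<union> insert (Suc k) ` distinct_parts (Suc k) (n - Suc k)"
  proof (intro equalityI subsetI)
    fix S assume S: "S \<in> distinct_parts k n"
    show "S \<in> distinct_parts (Suc k) n \<union> insert (Suc k) ` distinct_parts (Suc k) (n - Suc k)"
    proof (cases "Suc k \<in> S")
      case True
      hence "S - {Suc k} \<in> distinct_parts (Suc k) (n - Suc k)"
        using S unfolding distinct_parts_def by (auto simp: sum_diff1_nat Suc_lessI)
      moreover have "S = insert (Suc k) (S - {Suc k})" using True by auto
      ultimately show ?thesis by blast
    next
      case False
      hence "S \<in> distinct_parts (Suc k) n" using S unfolding distinct_parts_def by (auto intro: Suc_lessI)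
      thus ?thesis by blast
    qed
  next
    fix S assume "S \<in> distinct_parts (Suc k) n \<union> insert (Suc k) ` distinct_parts (Suc k) (n - Suc k)"
    thus "S \<in> distinct_parts k n"
    proof
      assume "S \<in> insert (Suc k) ` distinct_parts (Suc k) (n - Suc k)"
      then obtain T where "S = insert (Suc k) T" "T \<in> distinct_parts (Suc k) (n - Suc k)" by blast
      moreover from this have "Suc k \<notin> T" unfolding distinct_parts_def by auto
      ultimately show ?thesis using assms unfolding distinct_parts_def by auto
    qed (auto simp: distinct_parts_def)
  qed
  also have "card \<dots> = card (distinct_parts (Suc k) n) + card (insert (Suc k) ` distinct_parts (Suc k) (n - Suc k))"
    by (intro card_Un_disjoint finite_imageI finite_distinct_parts) (auto simp: distinct_parts_def)
  also have "card (insert (Suc k) ` distinct_parts (Suc k) (n - Suc k)) = card (distinct_parts (Suc k) (n - Suc k))"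
  proof (rule card_image, rule inj_onI)
    fix S T assume "S \<in> distinct_parts (Suc k) (n - Suc k)" "T \<in> distinct_parts (Suc k) (n - Suc k)"
      and eq: "insert (Suc k) S = insert (Suc k) T"
    hence "Suc k \<notin> S" "Suc k \<notin> T" unfolding distinct_parts_def by auto
    thus "S = T" using eq by (metis insert_ident)
  qed
  finally show ?thesis .
qed

text \<open>The largest part is the one that can always grow by one without meeting another part.
  This turns nonempty partitions of \<open>n\<close> into distinct parts into such partitions of
  \<open>n + 1\<close>.\<close>

definition raise_max :: "nat set \<Rightarrow> nat set" where
  "raise_max S = insert (Suc (Max S)) (S - {Max S})"

text \<open>The last two facts recover \<open>Max S\<close> and then \<open>S\<close> from
  \<open>raise_max S\<close>, which yields injectivity.\<close>

lemma raise_max_props: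
  assumes "finite S" "S \<noteq> {}"
  shows "\<Sum>(raise_max S) = Suc (\<Sum>S)" "Max (raise_max S) = Suc (Max S)"
    "S = insert (Max S) (raise_max S - {Suc (Max S)})"
proof -
  have n: "Suc (Max S) \<notin> S" using assms Max_ge Suc_n_not_le_n by blast
  have "\<Sum>(raise_max S) = Suc (Max S) + \<Sum>(S - {Max S})"
    unfolding raise_max_def using assms n by (subst sum.insert) auto
  also have "\<dots> = Suc (\<Sum>S)" using assms by (simp add: sum.remove[of S "Max S"])
  finally show "\<Sum>(raise_max S) = Suc (\<Sum>S)" .
  show "Max (raise_max S) = Suc (Max S)"
    unfolding raise_max_def using assms by (intro Max_eqI) (auto intro: le_SucI)
  show "S = insert (Max S) (raise_max S - {Suc (Max S)})"
    unfolding raise_max_def using n Max_in[OF assms] by auto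
qed

text \<open>\<open>raise_max\<close> is an injection. Positivity of \<open>n\<close> excludes the
  empty set: 0 has one partition into parts above \<open>k\<close>, whereas 1 has none if
  \<open>k > 0\<close>.\<close>

lemma card_distinct_parts_Suc_ge:
  assumes "n > 0"
  shows "card (distinct_parts k n) \<le> card (distinct_parts k (Suc n))"
proof (rule card_inj_on_le)
  have ne: "finite S" "S \<noteq> {}" if "S \<in> distinct_parts k n" for S
    using that assms unfolding distinct_parts_def by auto
  show "inj_on raise_max (distinct_parts k n)"
  proof (rule inj_onI)
    fix S T assume ST: "S \<in> distinct_parts k n" "T \<in> distinct_parts k n" "raise_max S = raise_max T"
    note S = raise_max_props[OF ne[OF ST(1)]] and T = raise_max_props[OF ne[OF ST(2)]]
    have "Max S = Max T" using S(2) T(2) ST(3) by simp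
    thus "S = T" using S(3) T(3) ST(3) by metis
  qed
  show "raise_max ` distinct_parts k n \<subseteq> distinct_parts k (Suc n)"
  proof (rule image_subsetI)
    fix S assume S: "S \<in> distinct_parts k n"
    note ne = ne[OF S]
    have "Max S \<in> S" using ne by simp
    thus "raise_max S \<in> distinct_parts k (Suc n)"
      using raise_max_props(1)[OF ne] S unfolding distinct_parts_def by (auto simp: raise_max_def)
  qed
qed simp

lemma card_distinct_parts_mono:
  assumes "0 < m" "m \<le> n"
  shows "card (distinct_parts k m) \<le> card (distinct_parts k n)"
  using assms(2)
proof (induction n rule: dec_induct)
  case (step i)
  thus ?case using card_distinct_parts_Suc_ge[of i k] assms(1) by simp
qed simp

lemma distinct_parts_ratio_limit:
  defines "Q \<equiv> \<lambda>n. real (card (distinct_parts 0 n))"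
  assumes Qpos: "eventually (\<lambda>n. Q n > 0) sequentially"
  assumes Qshift: "\<And>j. (\<lambda>n. Q (n + j) / Q n) \<longlonglongrightarrow> 1"
  shows "(\<lambda>n. real (card (distinct_parts k n)) / Q n) \<longlonglongrightarrow> (1 / 2) ^ k"
proof (induction k)
  case 0
  have "(\<lambda>n. Q n / Q n) \<longlonglongrightarrow> 1" using Qshift[of 0] by simp
  thus ?case by (simp add: Q_def)
next
  case (Suc k)
  let ?d = "\<lambda>k n. real (card (distinct_parts k n))"
  show ?case
    \<comment> \<open>By monotonicity \<open>?d (Suc k) (n - Suc k) \<le> ?d (Suc k) n\<close>, so the recursion
      \<open>?d k n = ?d (Suc k) n + ?d (Suc k) (n - Suc k)\<close> bounds \<open>?d (Suc k) n\<close> on both sides.\<close>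
  proof (rule tendsto_sandwich[where f = "\<lambda>n. ?d k n / Q n / 2"
        and h = "\<lambda>n. ?d k (n + Suc k) / Q (n + Suc k) * (Q (n + Suc k) / Q n) / 2"])
    have "(\<lambda>n. ?d k (n + Suc k) / Q (n + Suc k) * (Q (n + Suc k) / Q n) / 2) \<longlonglongrightarrow> (1 / 2) ^ k * 1 / 2"
      by (intro tendsto_intros LIMSEQ_ignore_initial_segment[OF Suc.IH] Qshift) auto
    thus "(\<lambda>n. ?d k (n + Suc k) / Q (n + Suc k) * (Q (n + Suc k) / Q n) / 2) \<longlonglongrightarrow> (1 / 2) ^ Suc k" by simp
    have "(\<lambda>n. ?d k n / Q n / 2) \<longlonglongrightarrow> (1 / 2) ^ k / 2" by (intro tendsto_intros Suc.IH) auto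
    thus "(\<lambda>n. ?d k n / Q n / 2) \<longlonglongrightarrow> (1 / 2) ^ Suc k" by simp
    show "eventually (\<lambda>n. ?d k n / Q n / 2 \<le> ?d (Suc k) n / Q n) sequentially"
      using Qpos eventually_gt_at_top[of "Suc k"]
    proof eventually_elim
      case (elim n)
      have "card (distinct_parts k n) \<le> 2 * card (distinct_parts (Suc k) n)"
        using distinct_parts_rec[of k n] card_distinct_parts_mono[of "n - Suc k" n "Suc k"] elim by simp
      hence "?d k n \<le> 2 * ?d (Suc k) n" by linarith
      thus ?case using elim by (simp add: field_simps)
    qed
    show "eventually (\<lambda>n. ?d (Suc k) n / Q n \<le> ?d k (n + Suc k) / Q (n + Suc k) * (Q (n + Suc k) / Q n) / 2) sequentially"
      using Qpos eventually_all_ge_at_top[OF Qpos] eventually_gt_at_top[of 0]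
    proof eventually_elim
      case (elim n)
      \<comment> \<open>The recursion is applied at \<open>n + Suc k\<close>, so that its second
        summand is the count at \<open>n\<close> itself. The factor
        \<open>Q (n + Suc k) / Q n\<close> in the upper bound pays for this shift.\<close>
      have "2 * card (distinct_parts (Suc k) n) \<le> card (distinct_parts k (n + Suc k))"
        using distinct_parts_rec[of k "n + Suc k"] card_distinct_parts_mono[of n "n + Suc k" "Suc k"] elim by simp
      hence "2 * ?d (Suc k) n \<le> ?d k (n + Suc k)" by linarith
      moreover have "Q (n + Suc k) > 0" using elim by (meson le_add1)
      moreover have "Q n > 0" using elim by blast
      ultimately show ?case by (simp add: divide_right_mono field_simps)
    qed
  qed
qed

section \<open>Distinct parts with odd smallest part\<close>

definition odd_min_parts :: "nat \<Rightarrow> nat set set" where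
  "odd_min_parts n = {S \<in> distinct_parts 0 n. odd (Min S)}"

text \<open>If all parts exceed \<open>k\<close>, the smallest one is \<open>Suc k\<close> or
  larger. Thus \<open>D k n - D (k + 1) n\<close> counts the partitions with smallest part
  \<open>Suc k\<close>; the additive form avoids truncated subtraction.\<close>

lemma card_Min_eq:
  assumes "n > 0"
  shows "card (distinct_parts k n) = card (distinct_parts (Suc k) n) + card {S \<in> distinct_parts 0 n. Min S = Suc k}"
proof -
  have ne: "finite S" "S \<noteq> {}" if "S \<in> distinct_parts i n" for S i
    using that assms unfolding distinct_parts_def by auto
  have "distinct_parts k n = distinct_parts (Suc k) n \<union> {S \<in> distinct_parts 0 n. Min S = Suc k}"
  proof (intro equalityI subsetI)
    fix S assume S: "S \<in> distinct_parts k n"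
    have "Min S > k" using S Min_in[OF ne[OF S]] unfolding distinct_parts_def by auto
    hence "Suc k < x" if "x \<in> S" "Min S \<noteq> Suc k" for x
      using Min_le[OF ne(1)[OF S] that(1)] that(2) by linarith
    thus "S \<in> distinct_parts (Suc k) n \<union> {S \<in> distinct_parts 0 n. Min S = Suc k}"
      using S unfolding distinct_parts_def by (cases "Min S = Suc k") auto
  next
    fix S assume "S \<in> distinct_parts (Suc k) n \<union> {S \<in> distinct_parts 0 n. Min S = Suc k}"
    thus "S \<in> distinct_parts k n"
    proof
      assume "S \<in> {S \<in> distinct_parts 0 n. Min S = Suc k}"
      hence S: "S \<in> distinct_parts 0 n" "Min S = Suc k" by auto
      thus ?thesis using Min_le[OF ne(1)[OF S(1)]] unfolding distinct_parts_def by (auto simp: Suc_le_eq)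
    qed (auto simp: distinct_parts_def)
  qed
  moreover have "distinct_parts (Suc k) n \<inter> {S \<in> distinct_parts 0 n. Min S = Suc k} = {}"
  proof -
    have "Min S \<noteq> Suc k" if "S \<in> distinct_parts (Suc k) n" for S
      using Min_in[OF ne[OF that]] that unfolding distinct_parts_def by auto
    thus ?thesis by auto
  qed
  ultimately show ?thesis by (simp add: card_Un_disjoint)
qed

text \<open>Grouping the terms \<open>2 * j\<close> and \<open>2 * j + 1\<close> of the alternating
  sum shows that \<open>A K\<close> counts exactly the partitions whose smallest part is odd and
  below \<open>2 * K\<close>. Those with a larger odd smallest part have all parts above
  \<open>2 * K\<close>.\<close>

lemma odd_min_parts_bounds:
  assumes "n > 0"
  defines "A \<equiv> \<lambda>K. \<Sum>k<2 * K. (-1) ^ k * real (card (distinct_parts k n))"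
  shows "A K \<le> real (card (odd_min_parts n))"
    and "real (card (odd_min_parts n)) \<le> A K + real (card (distinct_parts (2 * K) n))"
proof -
  let ?d = "\<lambda>k. real (card (distinct_parts k n))"
  define U where "U = (\<Union>j<K. {S \<in> distinct_parts 0 n. Min S = Suc (2 * j)})"
  have "real (card U) = (\<Sum>j<K. real (card {S \<in> distinct_parts 0 n. Min S = Suc (2 * j)}))"
    unfolding U_def by (subst card_UN_disjoint) auto
  also have "\<dots> = (\<Sum>j<K. ?d (2 * j) - ?d (Suc (2 * j)))"
  proof (rule sum.cong[OF refl])
    fix j
    show "real (card {S \<in> distinct_parts 0 n. Min S = Suc (2 * j)}) = ?d (2 * j) - ?d (Suc (2 * j))"
      using card_Min_eq[OF assms(1), of "2 * j"] by simp
  qed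
  also have "\<dots> = A K" unfolding A_def by (induction K) auto
  finally have cU: "real (card U) = A K" .
  have "U \<subseteq> odd_min_parts n" unfolding U_def odd_min_parts_def by auto
  moreover have fin: "finite (odd_min_parts n)" unfolding odd_min_parts_def by simp
  ultimately show "A K \<le> real (card (odd_min_parts n))" unfolding cU[symmetric] by (simp add: card_mono)
  have "odd_min_parts n \<subseteq> U \<union> distinct_parts (2 * K) n"
  proof
    fix S assume "S \<in> odd_min_parts n"
    hence S: "S \<in> distinct_parts 0 n" "odd (Min S)" unfolding odd_min_parts_def by auto
    then obtain j where j: "Min S = Suc (2 * j)" by (auto elim: oddE)
    show "S \<in> U \<union> distinct_parts (2 * K) n"
    proof (cases "j < K")
      case True
      thus ?thesis unfolding U_def using S j by auto
    next
      case False
      have "finite S" using S unfolding distinct_parts_def by auto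
      hence "2 * K < x" if "x \<in> S" for x using Min_le[of S x] that j False by simp
      thus ?thesis using S unfolding distinct_parts_def by auto
    qed
  qed
  hence "card (odd_min_parts n) \<le> card (U \<union> distinct_parts (2 * K) n)"
    by (intro card_mono) (auto simp: U_def)
  also have "\<dots> \<le> card U + card (distinct_parts (2 * K) n)" by (rule card_Un_le)
  finally show "real (card (odd_min_parts n)) \<le> A K + real (card (distinct_parts (2 * K) n))"
    unfolding cU[symmetric] by linarith
qed

lemma odd_min_parts_ratio_limit:
  defines "Q \<equiv> \<lambda>n. real (card (distinct_parts 0 n))"
  assumes Qpos: "eventually (\<lambda>n. Q n > 0) sequentially"
  assumes Qshift: "\<And>j. (\<lambda>n. Q (n + j) / Q n) \<longlonglongrightarrow> 1"
  shows "(\<lambda>n. real (card (odd_min_parts n)) / Q n) \<longlonglongrightarrow> 2 / 3"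
proof (rule LIMSEQ_I)
  fix \<epsilon> :: real assume \<epsilon>: "\<epsilon> > 0"
  let ?d = "\<lambda>k n. real (card (distinct_parts k n))"
  define A where "A = (\<lambda>K n. \<Sum>k<2 * K. (-1) ^ k * ?d k n)"
  \<comment> \<open>The first \<open>2 * K\<close> terms of the geometric series with ratio -1/2,
    whose full sum is 2/3.\<close>
  define a where "a = (\<lambda>K::nat. 2 / 3 * (1 - (1 / 4) ^ K) :: real)"
  have lim: "(\<lambda>n. ?d k n / Q n) \<longlonglongrightarrow> (1 / 2) ^ k" for k
    unfolding Q_def by (rule distinct_parts_ratio_limit[OF Qpos[unfolded Q_def] Qshift[unfolded Q_def]])
  have "(\<lambda>K. (1 / 4 :: real) ^ K) \<longlonglongrightarrow> 0" by (intro LIMSEQ_realpow_zero) auto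
  hence "eventually (\<lambda>K. (1 / 4 :: real) ^ K < \<epsilon>) sequentially" using \<epsilon> by (rule order_tendstoD)
  then obtain K where K: "(1 / 4 :: real) ^ K < \<epsilon>" by (auto simp: eventually_sequentially)
  have sum: "(\<Sum>k<2 * K. (-1) ^ k * (1 / 2) ^ k) = a K"
  proof -
    have "(\<Sum>k<2 * K. (-1) ^ k * (1 / 2) ^ k :: real) = (\<Sum>k<2 * K. (- 1 / 2) ^ k)"
      by (simp flip: power_mult_distrib)
    also have "\<dots> = a K" unfolding a_def by (subst sum_gp_strict) (simp add: power_mult power2_eq_square)
    finally show ?thesis .
  qed
  have "(\<lambda>n. \<Sum>k<2 * K. (-1) ^ k * (?d k n / Q n)) \<longlonglongrightarrow> (\<Sum>k<2 * K. (-1) ^ k * (1 / 2) ^ k)"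
    by (intro tendsto_intros lim)
  hence L: "(\<lambda>n. A K n / Q n) \<longlonglongrightarrow> a K"
    unfolding A_def sum by (simp add: sum_divide_distrib)
  have "(\<lambda>n. A K n / Q n + ?d (2 * K) n / Q n) \<longlonglongrightarrow> a K + (1 / 2) ^ (2 * K)"
    by (intro tendsto_add L lim)
  also have "(1 / 2 :: real) ^ (2 * K) = (1 / 4) ^ K" by (simp add: power_mult power2_eq_square)
  finally have U: "(\<lambda>n. A K n / Q n + ?d (2 * K) n / Q n) \<longlonglongrightarrow> a K + (1 / 4) ^ K" .
  have p: "(1 / 4 :: real) ^ K > 0" by simp
  have aK: "a K = 2 / 3 - 2 / 3 * (1 / 4) ^ K" by (simp only: a_def right_diff_distrib mult_1_right)
  \<comment> \<open>With \<open>K\<close> fixed, the lower bound tends to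
    \<open>2/3 - 2/3 * (1/4)^K\<close> and the upper one to \<open>2/3 + 1/3 * (1/4)^K\<close>; both
    are within \<epsilon> of 2/3 by the choice of \<open>K\<close>.\<close>
  have "eventually (\<lambda>n. A K n / Q n > 2 / 3 - \<epsilon>) sequentially"
    by (rule order_tendstoD(1)[OF L]) (use K p aK in linarith)
  moreover have "eventually (\<lambda>n. A K n / Q n + ?d (2 * K) n / Q n < 2 / 3 + \<epsilon>) sequentially"
    by (rule order_tendstoD(2)[OF U]) (use K p aK in linarith)
  ultimately have "eventually (\<lambda>n. norm (real (card (odd_min_parts n)) / Q n - 2 / 3) < \<epsilon>) sequentially"
    using Qpos eventually_gt_at_top[of 0]
  proof eventually_elim
    case (elim n)
    have "A K n / Q n \<le> real (card (odd_min_parts n)) / Q n"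
      using odd_min_parts_bounds(1)[of n K] elim unfolding A_def by (intro divide_right_mono) auto
    moreover have "real (card (odd_min_parts n)) / Q n \<le> (A K n + ?d (2 * K) n) / Q n"
      using odd_min_parts_bounds(2)[of n K] elim unfolding A_def by (intro divide_right_mono) auto
    ultimately show ?case using elim by (simp add: add_divide_distrib abs_less_iff)
  qed
  thus "\<exists>N. \<forall>n\<ge>N. norm (real (card (odd_min_parts n)) / Q n - 2 / 3) < \<epsilon>"
    by (simp add: eventually_sequentially)
qed

section \<open>Odd-even overpartitions\<close>

text \<open>Equal successive parts have the even difference 0, which would force an overline on a
  repeated occurrence. So the sizes strictly decrease, and then the rule on first occurrences holds
  automatically.\<close>

lemma odd_even_overpartition_iff:
  "odd_even_overpartition n ps \<longleftrightarrow>
     sorted_wrt (>) (map fst ps) \<and> (\<forall>p\<in>set ps. fst p > 0) \<and> sum_list (map fst ps) = n \<and>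
     (ps \<noteq> [] \<longrightarrow> odd (fst (last ps))) \<and>
     (\<forall>i. Suc i < length ps \<longrightarrow> (snd (ps ! Suc i) \<longleftrightarrow> even (fst (ps ! i) - fst (ps ! Suc i))))" (is "_ \<longleftrightarrow> ?R")
proof
  assume *: "odd_even_overpartition n ps"
  have flag: "snd (ps ! Suc i) \<longleftrightarrow> even (fst (ps ! i) - fst (ps ! Suc i))" if "Suc i < length ps" for i
  proof -
    have "if snd (ps ! Suc i) then even (fst (ps ! i) - fst (ps ! Suc i))
         else odd (fst (ps ! i) - fst (ps ! Suc i))"
      using * that unfolding odd_even_overpartition_def by blast
    thus ?thesis by (cases "snd (ps ! Suc i)") simp_all
  qed
  have "fst (ps ! Suc i) < fst (ps ! i)" if i: "Suc i < length ps" for i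
  proof -
    have "fst (ps ! Suc i) \<le> fst (ps ! i)"
      using * i unfolding odd_even_overpartition_def overpartition_def by (auto simp: sorted_wrt_iff_nth_less)
    moreover have "fst (ps ! Suc i) \<noteq> fst (ps ! i)"
    proof
      assume eq: "fst (ps ! Suc i) = fst (ps ! i)"
      hence "snd (ps ! Suc i)" using flag[OF i] by simp
      thus False using * i eq unfolding odd_even_overpartition_def overpartition_def by (metis lessI)
    qed
    ultimately show ?thesis by linarith
  qed
  hence "sorted_wrt (>) (map fst ps)"
    by (subst sorted_wrt_iff_nth_Suc_transp) (auto simp: transp_def)
  thus ?R using * flag unfolding odd_even_overpartition_def overpartition_def by blast
next
  assume R: ?R
  have ne: "fst (ps ! j) \<noteq> fst (ps ! i)" if "i < length ps" "j < i" for i j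
    using R that by (force simp: sorted_wrt_iff_nth_less)
  have "sorted_wrt (\<ge>) (map fst ps)"
    using R by (intro sorted_wrt_mono_rel[of _ "(>)" "(\<ge>)"]) auto
  thus "odd_even_overpartition n ps"
    using R ne unfolding odd_even_overpartition_def overpartition_def by auto
qed

text \<open>This allows the list of part sizes to be exchanged for the set of part sizes.\<close>

lemma strict_decreasing_list_of_set:
  fixes xs :: "'a :: linorder list"
  assumes "sorted_wrt (>) xs"
  shows "xs = rev (sorted_list_of_set (set xs))"
proof -
  have "sorted_wrt (<) (rev xs)" using assms by (simp add: sorted_wrt_rev)
  hence "sorted_list_of_set (set (rev xs)) = rev xs"
    by (intro sorted_list_of_set.idem_if_sorted_distinct) (auto simp: strict_sorted_iff)
  thus ?thesis by simp
qed

text \<open>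
  All flags but that of the largest part are forced by the parities of the differences.
\<close>
lemma OE_eq:
  assumes "n > 0"
  shows "OE n = 2 * card (odd_min_parts n)"
proof -
  \<comment> \<open>The head of the list is the largest part, so \<open>snd (hd ps)\<close> is the
    one free flag.\<close>
  define f where "f = (\<lambda>ps :: (nat \<times> bool) list. (set (map fst ps), snd (hd ps)))"
  have "bij_betw f {ps. odd_even_overpartition n ps} (odd_min_parts n \<times> UNIV)"
    unfolding bij_betw_def
  proof (intro conjI)
    show "inj_on f {ps. odd_even_overpartition n ps}"
    proof (rule inj_onI, clarify)
      fix ps qs :: "(nat \<times> bool) list"
      assume p: "odd_even_overpartition n ps" and q: "odd_even_overpartition n qs" and eq: "f ps = f qs"
      note p' = p[unfolded odd_even_overpartition_iff] and q' = q[unfolded odd_even_overpartition_iff]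
      have "map fst ps = rev (sorted_list_of_set (set (map fst ps)))"
        using p' by (intro strict_decreasing_list_of_set) auto
      also have "set (map fst ps) = set (map fst qs)" using eq unfolding f_def by simp
      also have "rev (sorted_list_of_set (set (map fst qs))) = map fst qs"
        using q' by (intro strict_decreasing_list_of_set[symmetric]) auto
      finally have m: "map fst ps = map fst qs" .
      hence len: "length ps = length qs" by (metis length_map)
      have fst_eq: "fst (ps ! i) = fst (qs ! i)" if "i < length ps" for i
        using m that len by (metis nth_map)
      show "ps = qs"
      proof (rule nth_equalityI[OF len])
        fix i assume i: "i < length ps"
        have "snd (ps ! i) = snd (qs ! i)"
        proof (cases i)
          case 0
          have "ps \<noteq> []" "qs \<noteq> []" using i len by auto
          thus ?thesis using eq 0 unfolding f_def by (simp add: hd_conv_nth)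
        next
          case (Suc j)
          hence "fst (ps ! j) - fst (ps ! Suc j) = fst (qs ! j) - fst (qs ! Suc j)"
            using fst_eq[of j] fst_eq[of "Suc j"] i by simp
          moreover have "snd (ps ! Suc j) \<longleftrightarrow> even (fst (ps ! j) - fst (ps ! Suc j))"
            using p' i Suc by blast
          moreover have "snd (qs ! Suc j) \<longleftrightarrow> even (fst (qs ! j) - fst (qs ! Suc j))"
            using q' i Suc len by auto
          ultimately show ?thesis unfolding Suc by (simp only:)
        qed
        thus "ps ! i = qs ! i" using fst_eq[OF i] by (simp add: prod_eq_iff)
      qed
    qed
    show "f ` {ps. odd_even_overpartition n ps} = odd_min_parts n \<times> UNIV"
    proof (intro equalityI subsetI)
      fix y assume "y \<in> f ` {ps. odd_even_overpartition n ps}"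
      then obtain ps where p: "odd_even_overpartition n ps" and y: "y = f ps" by auto
      note p' = p[unfolded odd_even_overpartition_iff]
      define S where "S = set (map fst ps)"
      \<comment> \<open>Here \<open>n > 0\<close> enters: \<open>hd\<close>, \<open>last\<close> and
        \<open>Min\<close> are meaningful only for a nonempty partition.\<close>
      have ne: "ps \<noteq> []" using p' assms by auto
      have xs: "map fst ps = rev (sorted_list_of_set S)"
        unfolding S_def using p' by (intro strict_decreasing_list_of_set) auto
      have S: "finite S" "S \<noteq> {}" unfolding S_def using ne by auto
      have "\<Sum>S = sum_list (map fst ps)" unfolding xs using S by (simp add: sum_list_rev sum_list_distinct_conv_sum_set[of _ "\<lambda>x. x", simplified])
      moreover have "fst (last ps) = Min S"
      proof -
        have "fst (last ps) = last (map fst ps)" using ne by (simp add: last_map)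
        also have "\<dots> = hd (sorted_list_of_set S)" unfolding xs using S by (simp add: last_rev)
        also have "\<dots> = Min S" using S by (simp add: sorted_list_of_set_nonempty)
        finally show ?thesis .
      qed
      ultimately have "S \<in> odd_min_parts n"
        using p' ne S unfolding odd_min_parts_def distinct_parts_def by (auto simp: S_def)
      thus "y \<in> odd_min_parts n \<times> UNIV" unfolding y f_def S_def by simp
    next
      fix y :: "nat set \<times> bool" assume "y \<in> odd_min_parts n \<times> UNIV"
      then obtain S b where y: "y = (S, b)" and So: "S \<in> odd_min_parts n" by auto
      have S: "finite S" "S \<noteq> {}" "\<And>x. x \<in> S \<Longrightarrow> x > 0" "\<Sum>S = n" "odd (Min S)"
        using So assms unfolding odd_min_parts_def distinct_parts_def by auto
      define xs where "xs = rev (sorted_list_of_set S)"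
      \<comment> \<open>The preimage of \<open>(S, b)\<close>: index 0, the largest part, receives
        the free flag \<open>b\<close>, and every later flag is read off from the parity of the
        preceding difference.\<close>
      define ps where "ps = map (\<lambda>i. (xs ! i, if i = 0 then b else even (xs ! (i - 1) - xs ! i))) [0..<length xs]"
      have xs: "sorted_wrt (>) xs" "set xs = S" "xs \<noteq> []"
        unfolding xs_def using S by (auto simp: sorted_wrt_rev)
      have mf: "map fst ps = xs" unfolding ps_def by (rule nth_equalityI) auto
      have ne: "ps \<noteq> []" using mf xs by auto
      have last: "fst (last ps) = Min S"
      proof -
        have "fst (last ps) = last xs" using ne mf by (metis last_map)
        also have "\<dots> = hd (sorted_list_of_set S)" unfolding xs_def using S by (simp add: last_rev)
        also have "\<dots> = Min S" using S by (simp add: sorted_list_of_set_nonempty)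
        finally show ?thesis .
      qed
      have sum: "sum_list xs = n"
        unfolding xs_def using S by (simp add: sum_list_rev sum_list_distinct_conv_sum_set[of _ "\<lambda>x. x", simplified])
      have pos: "\<forall>p\<in>set ps. fst p > 0" using mf xs(2) S(3) by (metis image_eqI list.set_map)
      have "odd_even_overpartition n ps"
        unfolding odd_even_overpartition_iff mf
      proof (intro conjI allI impI)
        fix i assume "Suc i < length ps"
        thus "snd (ps ! Suc i) \<longleftrightarrow> even (fst (ps ! i) - fst (ps ! Suc i))" unfolding ps_def by simp
      qed (use xs pos sum last S in auto)
      moreover have "f ps = y"
      proof -
        have "snd (hd ps) = b" using ne xs(3) by (simp add: hd_conv_nth ps_def)
        thus ?thesis unfolding f_def y mf xs(2) by simp
      qed
      ultimately show "y \<in> f ` {ps. odd_even_overpartition n ps}" by blast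
    qed
  qed
  hence "card {ps. odd_even_overpartition n ps} = card (odd_min_parts n \<times> (UNIV :: bool set))"
    by (rule bij_betw_same_card)
  thus ?thesis unfolding OE_def by (simp add: card_cartesian_product)
qed

section \<open>The generating function near the positive axis\<close>

text \<open>The modulus of \<open>exp z\<close> is \<open>exp (Re z)\<close>, so the reverse
  triangle inequality reduces this to the real bound \<open>1 + x \<le> exp x\<close>.\<close>

lemma norm_exp_minus_one_ge:
  fixes z :: complex
  assumes "Re z \<ge> 0"
  shows "Re z \<le> cmod (exp z - 1)"
proof -
  have "Re z \<le> exp (Re z) - 1" using exp_ge_add_one_self[of "Re z"] by linarith
  also have "\<dots> \<le> cmod (exp z - 1)"
    using norm_triangle_ineq2[of "exp z" 1] by simp
  finally show ?thesis .
qed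

text \<open>What remains of \<open>1 / (exp z - 1)\<close> after its Laurent terms
  \<open>1 / z\<close> and \<open>- 1 / 2\<close> at 0 are removed; it behaves like
  \<open>z / 12\<close> near 0.\<close>

definition planck_rem :: "complex \<Rightarrow> complex" where
  "planck_rem z = 1 / (exp z - 1) - 1 / z + 1 / 2"

text \<open>In the cone \<open>|z| \<le> 4 * Re z\<close>, hence
  \<open>|exp z - 1| \<ge> |z| / 4\<close>. For \<open>|z| \<ge> 1\<close> the three terms are
  bounded separately; for smaller \<open>z\<close> they are put over a common denominator of order
  \<open>|z|^2\<close>, with a numerator of order \<open>|z|^3\<close>.\<close>

lemma planck_rem_bound:
  assumes "Re z > 0" "\<bar>Im z\<bar> \<le> 3 * Re z"
  shows "cmod (planck_rem z) \<le> 10" and "cmod (planck_rem z) \<le> 10 * cmod z"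
proof -
  have nz: "z \<noteq> 0" using assms(1) by auto
  have "cmod z \<le> \<bar>Re z\<bar> + \<bar>Im z\<bar>" by (rule cmod_le)
  hence z4: "cmod z / 4 \<le> Re z" using assms by linarith
  also have "\<dots> \<le> cmod (exp z - 1)" using assms by (intro norm_exp_minus_one_ge) auto
  finally have low: "cmod z / 4 \<le> cmod (exp z - 1)" .
  have zpos: "cmod z > 0" using nz by simp
  have epos: "cmod (exp z - 1) > 0" using low zpos by linarith
  hence enz: "exp z - 1 \<noteq> 0" by auto
  have "cmod (planck_rem z) \<le> 10 \<and> cmod (planck_rem z) \<le> 10 * cmod z"
  proof (cases "cmod z \<ge> 1")
    case True
    have "cmod (planck_rem z) \<le> cmod (1 / (exp z - 1)) + cmod (1 / z) + cmod (1 / 2)"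
      unfolding planck_rem_def by (meson norm_triangle_ineq norm_triangle_ineq4 add_mono order_trans order_refl)
    moreover have "cmod (1 / (exp z - 1)) \<le> 4"
    proof -
      have "1 \<le> 4 * cmod (exp z - 1)" using low True by linarith
      thus ?thesis using epos by (simp add: norm_divide divide_simps)
    qed
    moreover have "cmod (1 / z) \<le> 1" using True by (simp add: norm_divide divide_simps)
    ultimately have "cmod (planck_rem z) \<le> 10" by (simp add: norm_divide)
    thus ?thesis using True by linarith
  next
    case False
    define R where "R = exp z - (1 + z + z\<^sup>2 / 2)"
    have "cmod (exp z - (\<Sum>k\<le>2. z ^ k / fact k)) \<le> exp (norm z) * cmod z ^ Suc 2 / fact 2"
      by (rule Taylor_exp_field)
    also have "(\<Sum>k\<le>2. z ^ k / fact k) = 1 + z + z\<^sup>2 / 2"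
      by (simp add: numeral_2_eq_2)
    also have "exp (norm z) * cmod z ^ Suc 2 / fact 2 \<le> 3 * cmod z ^ Suc 2 / fact 2"
    proof -
      have "exp (norm z) \<le> exp 1" using False by simp
      also have "\<dots> \<le> (3::real)" by (rule exp_le)
      finally show ?thesis by (intro divide_right_mono mult_right_mono) auto
    qed
    finally have R: "cmod R \<le> 3 / 2 * cmod z ^ 3" unfolding R_def by (simp add: numeral_3_eq_3)
    \<comment> \<open>The terms of degree 1 and 2 of the numerator cancel.\<close>
    have "2 * z - (2 - z) * (exp z - 1) = z ^ 3 / 2 - (2 - z) * R"
      unfolding R_def by (simp add: field_simps power2_eq_square power3_eq_cube)
    hence "cmod (2 * z - (2 - z) * (exp z - 1)) \<le> cmod (z ^ 3 / 2) + cmod ((2 - z) * R)"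
      by (simp only: norm_triangle_ineq4)
    also have "cmod ((2 - z) * R) \<le> 3 * (3 / 2 * cmod z ^ 3)"
      unfolding norm_mult
    proof (rule mult_mono)
      show "cmod (2 - z) \<le> 3" using norm_triangle_ineq4[of 2 z] False by simp
    qed (use R in auto)
    finally have num: "cmod (2 * z - (2 - z) * (exp z - 1)) \<le> 5 * cmod z ^ 3"
      by (simp add: norm_divide norm_power)
    have eq: "planck_rem z = (2 * z - (2 - z) * (exp z - 1)) / (2 * z * (exp z - 1))"
      using nz enz unfolding planck_rem_def by (simp add: field_simps)
    have den: "cmod (2 * z * (exp z - 1)) \<ge> cmod z ^ 2 / 2"
    proof -
      have "cmod z * (cmod z / 4) \<le> cmod z * cmod (exp z - 1)" using low by (intro mult_left_mono) auto
      thus ?thesis by (simp add: norm_mult power2_eq_square)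
    qed
    have "cmod (planck_rem z) \<le> 5 * cmod z ^ 3 / (cmod z ^ 2 / 2)"
      unfolding eq norm_divide using num den zpos by (intro frac_le) auto
    also have "\<dots> = 10 * cmod z" using zpos by (simp add: power2_eq_square power3_eq_cube)
    finally show ?thesis using False by linarith
  qed
  thus "cmod (planck_rem z) \<le> 10" "cmod (planck_rem z) \<le> 10 * cmod z" by auto
qed

text \<open>
  Cauchy's inequality on the disc of radius \<open>|z| / 8\<close>, which stays inside the wider cone
  of \<open>planck_rem_bound\<close>.
\<close>
lemma deriv_planck_rem_bound:
  fixes z :: complex
  assumes "Re z > 0" "\<bar>Im z\<bar> \<le> Re z"
  defines "chi \<equiv> \<lambda>w. planck_rem w / w"
  shows "(chi has_field_derivative deriv chi z) (at z)"
    and "cmod (deriv chi z) \<le> 96 * cmod z powr (-3/2)"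
proof -
  have z2: "cmod z \<le> 2 * Re z" using cmod_le[of z] assms by linarith
  have zpos: "cmod z > 0" using assms(1) by auto
  define r where "r = cmod z / 8"
  have rpos: "r > 0" using zpos unfolding r_def by simp
  \<comment> \<open>Since \<open>Re z \<ge> |z| / 2\<close>, a move by at most
    \<open>|z| / 8\<close> widens the slope from 1 to at most 3 and shrinks the modulus by a factor
    of at least 7/8.\<close>
  have cone: "Re w > 0 \<and> \<bar>Im w\<bar> \<le> 3 * Re w \<and> 7/8 * cmod z \<le> cmod w" if "w \<in> cball z r" for w
  proof -
    have d: "cmod (z - w) \<le> cmod z / 8" using that by (simp add: r_def dist_norm)
    have "\<bar>Re z - Re w\<bar> \<le> cmod z / 8" using abs_Re_le_cmod[of "z - w"] d by simp
    moreover have "\<bar>Im z - Im w\<bar> \<le> cmod z / 8" using abs_Im_le_cmod[of "z - w"] d by simp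
    moreover have "cmod z - cmod w \<le> cmod (z - w)" by (rule norm_triangle_ineq2)
    ultimately show ?thesis using z2 d assms(1,2) by linarith
  qed
  have nz: "exp w \<noteq> 1" if "Re w > 0" for w :: complex
  proof
    assume "exp w = 1"
    hence "cmod (exp w) = 1" by simp
    thus False using that by simp
  qed
  have hol: "chi holomorphic_on cball z r"
    unfolding chi_def planck_rem_def by (intro holomorphic_intros) (use cone nz in \<open>fastforce+\<close>)
  have hol': "chi holomorphic_on ball z r" using hol by (rule holomorphic_on_subset) auto
  show "(chi has_field_derivative deriv chi z) (at z)"
    using hol' rpos by (intro holomorphic_derivI[where S="ball z r"]) auto
  have b: "cmod (chi w) \<le> min 10 (12 / cmod z)" if "w \<in> cball z r" for w
  proof -
    note c = cone[OF that]
    have wpos: "cmod w > 0" using c zpos by linarith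
    have 1: "cmod (planck_rem w) \<le> 10" "cmod (planck_rem w) \<le> 10 * cmod w"
      using c planck_rem_bound by auto
    have "cmod (chi w) \<le> 10" unfolding chi_def norm_divide using 1 wpos by (simp add: divide_simps)
    moreover have "cmod (chi w) \<le> 10 / (7/8 * cmod z)" unfolding chi_def norm_divide
      using 1 c zpos by (intro frac_le) auto
    moreover have "10 / (7/8 * cmod z) \<le> 12 / cmod z" using zpos by (simp add: divide_simps)
    ultimately show ?thesis by linarith
  qed
  have "cmod ((deriv ^^ 1) chi z) \<le> fact 1 * min 10 (12 / cmod z) / r ^ 1"
    by (rule Cauchy_inequality[OF hol' _ rpos])
       (use holomorphic_on_imp_continuous_on[OF hol] b in \<open>auto simp: dist_norm\<close>)
  hence d: "cmod (deriv chi z) \<le> 8 * min 10 (12 / cmod z) / cmod z" by (simp add: r_def mult.commute)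
  \<comment> \<open>The derivative is of order \<open>1 / |z|\<close> for small \<open>z\<close> and
    \<open>1 / |z|^2\<close> for large \<open>z\<close>. The exponent -3/2 covers both: beyond 1 it
    makes the sum over multiples of \<tau> converge, and below 2 it leaves a positive power of
    \<open>|\<tau>|\<close> after multiplication by \<open>|\<tau>|^2\<close>.\<close>
  show "cmod (deriv chi z) \<le> 96 * cmod z powr (-3/2)"
  proof (cases "cmod z \<ge> 1")
    case True
    have "8 * min 10 (12 / cmod z) / cmod z \<le> 8 * (12 / cmod z) / cmod z"
      using zpos by (intro divide_right_mono) auto
    also have "\<dots> = 96 * cmod z powr (-2)"
      using zpos by (simp add: powr_minus powr_numeral power2_eq_square divide_simps)
    also have "\<dots> \<le> 96 * cmod z powr (-3/2)"
      using True by (intro mult_left_mono powr_mono) auto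
    finally show ?thesis using d by linarith
  next
    case False
    have "8 * min 10 (12 / cmod z) / cmod z \<le> 8 * 12 / cmod z"
      using zpos by (intro divide_right_mono) auto
    also have "\<dots> = 96 * cmod z powr (-1)"
      using zpos by (simp add: powr_minus divide_simps)
    also have "\<dots> \<le> 96 * cmod z powr (-3/2)"
      using False zpos by (intro mult_left_mono powr_mono') auto
    finally show ?thesis using d by linarith
  qed
qed

text \<open>The mean value inequality along the segment from \<open>a * \<tau>\<close> to
  \<open>b * \<tau>\<close>, which stays in the cone and has its smallest modulus at
  \<open>a * \<tau>\<close>.\<close>

lemma planck_rem_diff_bound:
  fixes \<tau> :: complex
  assumes "Re \<tau> > 0" "\<bar>Im \<tau>\<bar> \<le> Re \<tau>" "0 < a" "a \<le> b"
  defines "chi \<equiv> \<lambda>w. planck_rem w / w"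
  shows "cmod (chi (of_real a * \<tau>) - chi (of_real b * \<tau>)) \<le> 96 * (a * cmod \<tau>) powr (-3/2) * ((b - a) * cmod \<tau>)"
proof -
  let ?S = "closed_segment (of_real a * \<tau>) (of_real b * \<tau>)"
  have S: "\<exists>c\<ge>a. z = of_real c * \<tau>" if "z \<in> ?S" for z
  proof -
    obtain u where u: "0 \<le> u" "u \<le> 1" "z = (1 - u) *\<^sub>R (of_real a * \<tau>) + u *\<^sub>R (of_real b * \<tau>)"
      using \<open>z \<in> ?S\<close> by (auto simp: closed_segment_def)
    have "z = of_real (a + u * (b - a)) * \<tau>"
      using u(3) by (simp add: scaleR_conv_of_real algebra_simps)
    moreover have "a + u * (b - a) \<ge> a" using u assms by simp
    ultimately show ?thesis by blast
  qed
  have c: "0 < Re z \<and> \<bar>Im z\<bar> \<le> Re z \<and> a * cmod \<tau> \<le> cmod z" if z: "z \<in> ?S" for z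
  proof -
    obtain c where "c \<ge> a" "z = of_real c * \<tau>" using S[OF z] by blast
    thus ?thesis using assms(1-3) by (auto simp: norm_mult abs_mult intro!: mult_right_mono)
  qed
  have "cmod (chi (of_real a * \<tau>) - chi (of_real b * \<tau>)) \<le> (96 * (a * cmod \<tau>) powr (-3/2)) * cmod (of_real a * \<tau> - of_real b * \<tau>)"
  proof (rule field_differentiable_bound[where S="?S" and f'="deriv chi"])
    fix z assume z: "z \<in> ?S"
    note cz = c[OF z]
    show "(chi has_field_derivative deriv chi z) (at z within ?S)"
      using deriv_planck_rem_bound(1)[of z] cz unfolding chi_def
      by (auto intro: has_field_derivative_at_within)
    have "cmod (deriv chi z) \<le> 96 * cmod z powr (-3/2)"
      using deriv_planck_rem_bound(2)[of z] cz unfolding chi_def by auto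
    also have "\<dots> \<le> 96 * (a * cmod \<tau>) powr (-3/2)"
    proof -
      have "\<tau> \<noteq> 0" using assms(1) by auto
      thus ?thesis using cz assms(3) by (intro mult_left_mono powr_mono2') auto
    qed
    finally show "cmod (deriv chi z) \<le> 96 * (a * cmod \<tau>) powr (-3/2)" .
  qed auto
  also have "cmod (of_real a * \<tau> - of_real b * \<tau>) = (b - a) * cmod \<tau>"
  proof -
    have "of_real a * \<tau> - of_real b * \<tau> = of_real (a - b) * \<tau>" by (simp add: algebra_simps)
    thus ?thesis using assms(4) by (simp only: norm_mult norm_of_real) simp
  qed
  finally show ?thesis .
qed

section \<open>The logarithm of the generating function as \<tau> tends to 0\<close>

lemma alternating_inverse_squares_sums: "(\<lambda>k. (-1) ^ k / (real (Suc k))\<^sup>2) sums (pi\<^sup>2 / 12)"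
proof -
  have a: "(\<lambda>k. 1 / (real (Suc k))\<^sup>2) sums (pi\<^sup>2 / 6)"
    using inverse_squares_sums by (simp add: add.commute)
  have "summable (\<lambda>k. (-1) ^ k / (real (Suc k))\<^sup>2)"
    by (rule summable_norm_cancel) (use sums_summable[OF a] in \<open>simp add: norm_divide norm_power\<close>)
  then obtain s where s: "(\<lambda>k. (-1) ^ k / (real (Suc k))\<^sup>2) sums s" by (auto simp: summable_def)
  have two: "{n * 2..<n * 2 + 2} = {2 * n, Suc (2 * n)}" for n :: nat by auto
  have 1: "(\<lambda>n. 1 / (real (Suc (2 * n)))\<^sup>2 + 1 / (real (Suc (Suc (2 * n))))\<^sup>2) sums (pi\<^sup>2 / 6)"
    using sums_group[OF a, of 2] unfolding two by simp
  have 2: "(\<lambda>n. 1 / (real (Suc (2 * n)))\<^sup>2 - 1 / (real (Suc (Suc (2 * n))))\<^sup>2) sums s"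
    using sums_group[OF s, of 2] unfolding two by simp
  \<comment> \<open>The plain minus the alternating sum is twice the sum over even indices, that is,
    half of the plain sum.\<close>
  have "(\<lambda>n. 2 * (1 / (real (Suc (Suc (2 * n))))\<^sup>2)) sums (pi\<^sup>2 / 6 - s)"
    using sums_diff[OF 1 2] by simp
  also have "(\<lambda>n. 2 * (1 / (real (Suc (Suc (2 * n))))\<^sup>2)) = (\<lambda>n. 1/2 * (1 / (real (Suc n))\<^sup>2))"
  proof
    fix n
    have "real (Suc (Suc (2 * n))) = 2 * real (Suc n)" by simp
    thus "2 * (1 / (real (Suc (Suc (2 * n))))\<^sup>2) = 1/2 * (1 / (real (Suc n))\<^sup>2)"
      by (simp only: power_mult_distrib) (simp add: field_simps)
  qed
  finally have "(\<lambda>n. 1/2 * (1 / (real (Suc n))\<^sup>2)) sums (pi\<^sup>2 / 6 - s)" .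
  with sums_mult[OF a, of "1/2"] have "pi\<^sup>2 / 6 - s = 1/2 * (pi\<^sup>2 / 6)"
    using sums_unique2 by blast
  hence "s = pi\<^sup>2 / 12" by simp
  with s show ?thesis by simp
qed

text \<open>
  \<open>log_gf \<tau>\<close> is a logarithm of \<open>\<Prod>j\<ge>1. 1 + q^j\<close> at \<open>q = exp (- \<tau>)\<close>: expand \<open>ln (1 + q^j)\<close> and
  sum the geometric series over \<open>j\<close> first.
\<close>
definition log_gf :: "complex \<Rightarrow> complex" where
  "log_gf \<tau> = (\<Sum>k. (-1) ^ k / of_nat (Suc k) / (exp (of_nat (Suc k) * \<tau>) - 1))"

text \<open>The bound \<open>|exp (m * \<tau>) - 1| \<ge> m * Re \<tau>\<close> gives a majorant of
  order \<open>1 / m^2\<close>.\<close>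

lemma log_gf_summable:
  assumes "Re \<tau> > 0"
  shows "summable (\<lambda>k. cmod ((-1) ^ k / of_nat (Suc k) / (exp (of_nat (Suc k) * \<tau>) - 1)))"
proof (rule summable_comparison_test')
  show "summable (\<lambda>k. 1 / Re \<tau> * (1 / (real (Suc k))\<^sup>2))"
    using inverse_squares_sums by (intro summable_mult) (simp add: sums_iff add.commute)
next
  fix k :: nat
  have "Re (of_nat (Suc k) * \<tau>) \<le> cmod (exp (of_nat (Suc k) * \<tau>) - 1)"
    using assms by (intro norm_exp_minus_one_ge) simp
  hence "real (Suc k) * Re \<tau> \<le> cmod (exp (of_nat (Suc k) * \<tau>) - 1)" by simp
  moreover have "0 < real (Suc k) * Re \<tau>" using assms by simp
  ultimately have "1 / real (Suc k) / cmod (exp (of_nat (Suc k) * \<tau>) - 1) \<le> 1 / real (Suc k) / (real (Suc k) * Re \<tau>)"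
    by (intro divide_left_mono mult_pos_pos) (linarith, simp, linarith, simp, rule assms)
  also have "\<dots> = 1 / Re \<tau> * (1 / (real (Suc k))\<^sup>2)" by (simp add: power2_eq_square)
  finally show "norm (cmod ((-1) ^ k / of_nat (Suc k) / (exp (of_nat (Suc k) * \<tau>) - 1))) \<le> 1 / Re \<tau> * (1 / (real (Suc k))\<^sup>2)"
    by (simp add: norm_divide norm_power norm_mult del: of_nat_Suc)
qed

text \<open>Expand each \<open>1 / (exp (m * \<tau>) - 1)\<close>: the pole sums to the main term by
  the alternating inverse squares, the constant -1/2 to \<open>- ln 2 / 2\<close> by the alternating
  harmonic series, and \<open>planck_rem\<close> to the error.\<close>

lemma log_gf_asymp:
  obtains C where "\<And>\<tau>. Re \<tau> > 0 \<Longrightarrow> \<bar>Im \<tau>\<bar> \<le> Re \<tau> \<Longrightarrow>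
     cmod (log_gf \<tau> - of_real (pi\<^sup>2 / 12) / \<tau> + of_real (ln 2 / 2)) \<le> C * sqrt (cmod \<tau>)"
proof
  let ?C = "96 * (\<Sum>n. real (Suc n) powr (-3/2))"
  fix \<tau> :: complex assume \<tau>: "Re \<tau> > 0" "\<bar>Im \<tau>\<bar> \<le> Re \<tau>"
  define chi where "chi = (\<lambda>w. planck_rem w / w)"
  have tnz: "\<tau> \<noteq> 0" and tpos: "cmod \<tau> > 0" using \<tau> by auto
  have 1: "(\<lambda>k. (-1) ^ k / of_nat (Suc k) / (exp (of_nat (Suc k) * \<tau>) - 1)) sums log_gf \<tau>"
    unfolding log_gf_def by (intro summable_sums summable_norm_cancel[OF log_gf_summable] \<tau>)
  have "(\<lambda>k. of_real ((-1) ^ k / (real (Suc k))\<^sup>2) / \<tau>) sums (of_real (pi\<^sup>2 / 12) / \<tau>)"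
    by (intro sums_divide sums_of_real alternating_inverse_squares_sums)
  moreover have "(\<lambda>k. of_real ((-1) ^ k / real (Suc k)) / 2) sums (of_real (ln 2) / 2 :: complex)"
    by (intro sums_divide sums_of_real alternating_harmonic_series_sums)
  ultimately have "(\<lambda>k. (-1) ^ k / of_nat (Suc k) / (exp (of_nat (Suc k) * \<tau>) - 1)
      - of_real ((-1) ^ k / (real (Suc k))\<^sup>2) / \<tau> + of_real ((-1) ^ k / real (Suc k)) / 2) sums 
     (log_gf \<tau> - of_real (pi\<^sup>2 / 12) / \<tau> + of_real (ln 2) / 2)"
    by (intro sums_add sums_diff 1)
  also have "(\<lambda>k. (-1) ^ k / of_nat (Suc k) / (exp (of_nat (Suc k) * \<tau>) - 1)
      - of_real ((-1) ^ k / (real (Suc k))\<^sup>2) / \<tau> + of_real ((-1) ^ k / real (Suc k)) / 2)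
      = (\<lambda>k. \<tau> * ((-1) ^ k * chi (of_nat (Suc k) * \<tau>)))"
  proof
    fix k
    define m :: complex where "m = of_nat (Suc k)"
    define X where "X = exp (m * \<tau>) - 1"
    have mnz: "m \<noteq> 0" unfolding m_def by (simp del: of_nat_Suc)
    have "(-1) ^ k / m / X - (-1) ^ k / m\<^sup>2 / \<tau> + (-1) ^ k / m / 2 
       = (-1) ^ k / m * (1 / X - 1 / (m * \<tau>) + 1 / 2)"
      by (simp add: algebra_simps power2_eq_square)
    also have "\<dots> = \<tau> * ((-1) ^ k * chi (m * \<tau>))"
      using mnz tnz unfolding chi_def planck_rem_def X_def[symmetric] by simp
    finally show "(-1) ^ k / of_nat (Suc k) / (exp (of_nat (Suc k) * \<tau>) - 1)
      - of_real ((-1) ^ k / (real (Suc k))\<^sup>2) / \<tau> + of_real ((-1) ^ k / real (Suc k)) / 2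
      = \<tau> * ((-1) ^ k * chi (of_nat (Suc k) * \<tau>))"
      unfolding X_def m_def by (simp del: of_nat_Suc)
  qed
  finally have "(\<lambda>k. \<tau> * ((-1) ^ k * chi (of_nat (Suc k) * \<tau>))) sums 
      (log_gf \<tau> - of_real (pi\<^sup>2 / 12) / \<tau> + of_real (ln 2) / 2)" .
  \<comment> \<open>The terms have no summable majorant that is uniform in \<open>\<tau>\<close>, but the differences of consecutive ones do.\<close>
  from sums_group[OF this, of 2]
  have S: "(\<lambda>n. \<Sum>k\<in>{n*2..<n*2+2}. \<tau> * ((-1) ^ k * chi (of_nat (Suc k) * \<tau>))) sums 
      (log_gf \<tau> - of_real (pi\<^sup>2 / 12) / \<tau> + of_real (ln 2) / 2)" by simp
  have sm: "summable (\<lambda>n. real (Suc n) powr (-3/2))"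
    using summable_real_powr_iff[of "-3/2"] summable_Suc_iff[of "\<lambda>n. real n powr (-3/2)"] by simp
  have bd: "cmod (\<Sum>k\<in>{n*2..<n*2+2}. \<tau> * ((-1) ^ k * chi (of_nat (Suc k) * \<tau>)))
     \<le> 96 * sqrt (cmod \<tau>) * real (Suc n) powr (-3/2)" for n
  proof -
    have two: "{n * 2..<n * 2 + 2} = {2 * n, Suc (2 * n)}" by auto
    have "(\<Sum>k\<in>{n*2..<n*2+2}. \<tau> * ((-1) ^ k * chi (of_nat (Suc k) * \<tau>)))
       = \<tau> * (chi (of_real (real (2*n+1)) * \<tau>) - chi (of_real (real (2*n+2)) * \<tau>))"
      unfolding two by (simp add: algebra_simps)
    also have "cmod \<dots> \<le> cmod \<tau> * (96 * (real (2*n+1) * cmod \<tau>) powr (-3/2) * ((real (2*n+2) - real (2*n+1)) * cmod \<tau>))"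
      unfolding norm_mult chi_def using \<tau> by (intro mult_left_mono planck_rem_diff_bound) auto
    also have "\<dots> = 96 * ((cmod \<tau>)\<^sup>2 * (real (2*n+1) * cmod \<tau>) powr (-3/2))"
      by (simp add: power2_eq_square)
    also have "\<dots> \<le> 96 * ((cmod \<tau>)\<^sup>2 * (real (Suc n) * cmod \<tau>) powr (-3/2))"
      using tpos by (intro mult_left_mono powr_mono2') auto
    also have "\<dots> = 96 * ((cmod \<tau>)\<^sup>2 * (real (Suc n) powr (-3/2) * cmod \<tau> powr (-3/2)))"
      by (simp add: powr_mult)
    also have "(cmod \<tau>)\<^sup>2 = cmod \<tau> powr 2" using tpos by (simp add: powr_numeral)
    also have "96 * (cmod \<tau> powr 2 * (real (Suc n) powr (-3/2) * cmod \<tau> powr (-3/2)))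
      = 96 * (cmod \<tau> powr 2 * cmod \<tau> powr (-3/2)) * real (Suc n) powr (-3/2)" by simp
    also have "cmod \<tau> powr 2 * cmod \<tau> powr (-3/2) = sqrt (cmod \<tau>)"
      by (simp only: powr_add[symmetric]) (simp add: powr_half_sqrt)
    finally show ?thesis by simp
  qed
  have "cmod (log_gf \<tau> - of_real (pi\<^sup>2 / 12) / \<tau> + of_real (ln 2) / 2)
     = cmod (\<Sum>n. \<Sum>k\<in>{n*2..<n*2+2}. \<tau> * ((-1) ^ k * chi (of_nat (Suc k) * \<tau>)))"
    using S by (simp add: sums_iff)
  also have "\<dots> \<le> (\<Sum>n. 96 * sqrt (cmod \<tau>) * real (Suc n) powr (-3/2))"
    using bd sm by (intro norm_suminf_le summable_mult)
  also have "\<dots> = ?C * sqrt (cmod \<tau>)" using sm by (subst suminf_mult) auto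
  finally show "cmod (log_gf \<tau> - of_real (pi\<^sup>2 / 12) / \<tau> + of_real (ln 2 / 2)) \<le> ?C * sqrt (cmod \<tau>)"
    by simp
qed

section \<open>The generating function away from the positive axis\<close>

text \<open>Stopping the product at \<open>N\<close> cuts each inner geometric series after
  \<open>N\<close> terms. Its tail is \<open>(q ^ Suc k) ^ N\<close> times the whole series, so the
  logarithms differ by at most \<open>r ^ N\<close> times an absolutely convergent sum.\<close>

lemma gf_prod_tendsto:
  assumes "Re \<tau> > 0"
  shows "(\<lambda>N. \<Prod>j=1..N. (1 + exp (- (of_nat j * \<tau>)))) \<longlonglongrightarrow> exp (log_gf \<tau>)"
proof -
  define q where "q = exp (-\<tau>)"
  define r where "r = cmod q"
  have r: "0 \<le> r" "r < 1" unfolding r_def q_def using assms by auto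
  define t where "t = (\<lambda>k. (-1) ^ k / of_nat (Suc k) / (exp (of_nat (Suc k) * \<tau>) - 1))"
  have smt: "summable (\<lambda>k. cmod (t k))" unfolding t_def by (rule log_gf_summable[OF assms])
  have tsums: "t sums log_gf \<tau>"
    unfolding log_gf_def t_def by (intro summable_sums summable_norm_cancel[OF log_gf_summable] assms)
  have qj: "cmod (q ^ j) < 1" if "j \<ge> 1" for j
    using that r power_less_one_iff[of r j] unfolding r_def by (simp add: norm_power)
  have expq: "exp (- (of_nat j * \<tau>)) = q ^ j" for j
    unfolding q_def by (simp add: exp_of_nat_mult[symmetric])
  have lnq: "(\<lambda>k. (-1) ^ k / of_nat (Suc k) * (q ^ Suc k) ^ j) sums Ln (1 + q ^ j)" if "j \<ge> 1" for j
  proof -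
    have "(\<lambda>n. - ((- (q ^ j)) ^ n) / of_nat n) sums Ln (1 + q ^ j)"
      by (rule Ln_series') (use qj[OF that] in simp)
    hence "(\<lambda>k. - ((- (q ^ j)) ^ Suc k) / of_nat (Suc k)) sums Ln (1 + q ^ j)"
      by (subst sums_Suc_iff) simp
    also have "(\<lambda>k. - ((- (q ^ j)) ^ Suc k) / of_nat (Suc k)) = (\<lambda>k. (-1) ^ k / of_nat (Suc k) * (q ^ Suc k) ^ j)"
    proof
      fix k
      have "- ((- (q ^ j)) ^ Suc k) = (-1) ^ k * (q ^ j) ^ Suc k"
        by (subst power_minus) simp
      also have "(q ^ j) ^ Suc k = (q ^ Suc k) ^ j"
        by (simp only: power_mult[symmetric] mult.commute)
      finally show "- ((- (q ^ j)) ^ Suc k) / of_nat (Suc k) = (-1) ^ k / of_nat (Suc k) * (q ^ Suc k) ^ j"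
        by simp
    qed
    finally show ?thesis .
  qed
  have bound: "cmod (log_gf \<tau> - (\<Sum>j=1..N. Ln (1 + q ^ j))) \<le> r ^ N * (\<Sum>k. cmod (t k))" for N
  proof -
    have "(\<lambda>k. \<Sum>j=1..N. (-1) ^ k / of_nat (Suc k) * (q ^ Suc k) ^ j) sums (\<Sum>j=1..N. Ln (1 + q ^ j))"
      by (intro sums_sum lnq) auto
    from sums_diff[OF tsums this]
    have "(\<lambda>k. t k - (\<Sum>j=1..N. (-1) ^ k / of_nat (Suc k) * (q ^ Suc k) ^ j)) sums
        (log_gf \<tau> - (\<Sum>j=1..N. Ln (1 + q ^ j)))" .
    also have "(\<lambda>k. t k - (\<Sum>j=1..N. (-1) ^ k / of_nat (Suc k) * (q ^ Suc k) ^ j)) = (\<lambda>k. t k * (q ^ Suc k) ^ N)"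
    proof
      fix k
      define x where "x = q ^ Suc k"
      have x1: "x \<noteq> 1" using qj[of "Suc k"] unfolding x_def by auto
      have x0: "x \<noteq> 0" unfolding x_def q_def by simp
      have ex: "exp (of_nat (Suc k) * \<tau>) = 1 / x"
        unfolding x_def expq[symmetric] by (simp only: exp_minus inverse_eq_divide) simp
      have tk: "t k = (-1) ^ k / of_nat (Suc k) * (x / (1 - x))"
        using x0 x1 unfolding t_def ex by (simp add: divide_simps)
      have gs: "(\<Sum>j=1..N. x ^ j) = (x - x ^ Suc N) / (1 - x)"
      proof -
        have "(1 - x) * (\<Sum>j=1..N. x ^ j) = x - x ^ Suc N"
        proof (induction N)
          case (Suc N)
          have "(1 - x) * (\<Sum>j=1..Suc N. x ^ j) = (1 - x) * (\<Sum>j=1..N. x ^ j) + (1 - x) * x ^ Suc N"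
            by (simp add: distrib_left)
          also have "\<dots> = x - x ^ Suc N + (1 - x) * x ^ Suc N" by (simp only: Suc.IH)
          also have "\<dots> = x - x ^ Suc (Suc N)" by (simp add: algebra_simps)
          finally show ?case .
        qed simp
        thus ?thesis using x1 by (simp add: field_simps)
      qed
      have "t k - (\<Sum>j=1..N. (-1) ^ k / of_nat (Suc k) * x ^ j) =
         (-1) ^ k / of_nat (Suc k) * (x / (1 - x) - (\<Sum>j=1..N. x ^ j))"
        unfolding tk by (simp only: sum_distrib_left[symmetric] right_diff_distrib)
      also have "x / (1 - x) - (\<Sum>j=1..N. x ^ j) = x / (1 - x) * x ^ N"
      proof -
        have "x / (1 - x) - (x - x ^ Suc N) / (1 - x) = (x - (x - x ^ Suc N)) / (1 - x)"
          by (rule diff_divide_distrib[symmetric])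
        thus ?thesis unfolding gs by simp
      qed
      finally show "t k - (\<Sum>j=1..N. (-1) ^ k / of_nat (Suc k) * (q ^ Suc k) ^ j) = t k * (q ^ Suc k) ^ N"
        unfolding x_def[symmetric] by (simp only: tk mult.assoc)
    qed
    finally have S: "(\<lambda>k. t k * (q ^ Suc k) ^ N) sums (log_gf \<tau> - (\<Sum>j=1..N. Ln (1 + q ^ j)))" .
    have "cmod (log_gf \<tau> - (\<Sum>j=1..N. Ln (1 + q ^ j))) = cmod (\<Sum>k. t k * (q ^ Suc k) ^ N)"
      using S by (simp add: sums_iff)
    also have "\<dots> \<le> (\<Sum>k. r ^ N * cmod (t k))"
    proof (rule norm_suminf_le)
      fix k
      have "r ^ Suc k \<le> r" using power_decreasing[of 1 "Suc k" r] r by simp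
      hence "(r ^ Suc k) ^ N \<le> r ^ N" using r by (intro power_mono) auto
      hence "cmod (t k) * (r ^ Suc k) ^ N \<le> cmod (t k) * r ^ N" by (intro mult_left_mono) auto
      thus "cmod (t k * (q ^ Suc k) ^ N) \<le> r ^ N * cmod (t k)"
        by (simp only: norm_mult norm_power r_def[symmetric] mult.commute)
    qed (intro summable_mult smt)
    also have "\<dots> = r ^ N * (\<Sum>k. cmod (t k))" by (rule suminf_mult[OF smt])
    finally show ?thesis .
  qed
  have "(\<lambda>N. r ^ N * (\<Sum>k. cmod (t k))) \<longlonglongrightarrow> 0"
    using r by (intro tendsto_mult_left_zero LIMSEQ_realpow_zero) auto
  hence "(\<lambda>N. log_gf \<tau> - (\<Sum>j=1..N. Ln (1 + q ^ j))) \<longlonglongrightarrow> 0"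
    by (rule Lim_null_comparison[rotated]) (use bound in \<open>auto intro: always_eventually\<close>)
  hence "(\<lambda>N. log_gf \<tau> - (log_gf \<tau> - (\<Sum>j=1..N. Ln (1 + q ^ j)))) \<longlonglongrightarrow> log_gf \<tau> - 0"
    by (intro tendsto_diff tendsto_const)
  hence "(\<lambda>N. exp (\<Sum>j=1..N. Ln (1 + q ^ j))) \<longlonglongrightarrow> exp (log_gf \<tau>)"
    by (intro tendsto_exp) simp
  also have "(\<lambda>N. exp (\<Sum>j=1..N. Ln (1 + q ^ j))) = (\<lambda>N. \<Prod>j=1..N. (1 + exp (- (of_nat j * \<tau>))))"
  proof
    fix N
    have nz: "1 + q ^ j \<noteq> 0" if "j \<ge> 1" for j
      using qj[OF that] by (metis add_eq_0_iff norm_minus_cancel norm_one less_irrefl)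
    have "exp (\<Sum>j=1..N. Ln (1 + q ^ j)) = (\<Prod>j=1..N. exp (Ln (1 + q ^ j)))"
      by (rule exp_sum) simp
    also have "\<dots> = (\<Prod>j=1..N. (1 + exp (- (of_nat j * \<tau>))))"
      unfolding expq by (intro prod.cong refl exp_Ln nz) auto
    finally show "exp (\<Sum>j=1..N. Ln (1 + q ^ j)) = (\<Prod>j=1..N. (1 + exp (- (of_nat j * \<tau>))))" .
  qed
  finally show ?thesis .
qed

text \<open>With \<open>d = |z| - Re z\<close> one has
  \<open>|1 + z|^2 = (1 + |z|)^2 - 2 * d\<close>. As \<open>(1 + |z|)^2 \<le> 4\<close>, the
  subtraction is at least as strong as the... factor \<open>1 - d / 2\<close>, up to an inequality
  in the right direction, and \<open>1 - d / 2 \<le> exp (- d / 2)\<close>.\<close>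

lemma norm_one_plus_le:
  fixes z :: complex
  assumes "cmod z \<le> 1"
  shows "cmod (1 + z) \<le> (1 + cmod z) * exp (- (cmod z - Re z) / 4)"
proof (rule power2_le_imp_le)
  define d where "d = cmod z - Re z"
  have d: "d \<ge> 0" unfolding d_def using complex_Re_le_cmod[of z] by simp
  have "(cmod (1 + z))\<^sup>2 = (1 + cmod z)\<^sup>2 - 2 * d"
    unfolding d_def cmod_power2 by (simp add: power2_eq_square algebra_simps cmod_power2[unfolded power2_eq_square])
  also have "\<dots> \<le> (1 + cmod z)\<^sup>2 * (1 - d / 2)"
  proof -
    have "(1 + cmod z)\<^sup>2 \<le> 2\<^sup>2" using assms by (intro power_mono) auto
    hence "(1 + cmod z)\<^sup>2 * d \<le> 4 * d" using d by (intro mult_right_mono) auto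
    thus ?thesis by (simp add: algebra_simps)
  qed
  also have "\<dots> \<le> (1 + cmod z)\<^sup>2 * exp (- d / 2)"
    using exp_ge_add_one_self[of "- d / 2"] by (intro mult_left_mono) auto
  also have "exp (- d / 2) = (exp (- d / 4))\<^sup>2"
    by (simp add: power2_eq_square flip: exp_add)
  finally show "(cmod (1 + z))\<^sup>2 \<le> ((1 + cmod z) * exp (- (cmod z - Re z) / 4))\<^sup>2"
    unfolding d_def power_mult_distrib .
qed simp

lemma norm_gf_prod_le:
  assumes "Re \<tau> > 0"
  shows "cmod (\<Prod>j=1..N. (1 + exp (- (of_nat j * \<tau>)))) \<le> cmod (\<Prod>j=1..N. (1 + exp (- (of_nat j * of_real (Re \<tau>))))) *
    exp (- (\<Sum>j=1..N. cmod (exp (-\<tau>)) ^ j - Re (exp (-\<tau>) ^ j)) / 4)"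
proof -
  define q where "q = exp (-\<tau>)"
  have expq: "exp (- (of_nat j * \<tau>)) = q ^ j" for j
    unfolding q_def by (simp add: exp_of_nat_mult[symmetric])
  have expr: "exp (- (of_nat j * of_real (Re \<tau>))) = (of_real (cmod q ^ j) :: complex)" for j
    unfolding q_def by (simp add: exp_of_nat_mult[symmetric] flip: of_real_power exp_of_real)
  have q1: "cmod q \<le> 1" unfolding q_def using assms by simp
  have "cmod (\<Prod>j=1..N. (1 + q ^ j)) \<le> (\<Prod>j=1..N. (1 + cmod q ^ j) * exp (- (cmod q ^ j - Re (q ^ j)) / 4))"
    unfolding prod_norm[symmetric]
  proof (intro prod_mono conjI)
    fix j
    have "cmod (q ^ j) \<le> 1" using q1 by (simp add: norm_power power_le_one)
    from norm_one_plus_le[OF this]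
    show "cmod (1 + q ^ j) \<le> (1 + cmod q ^ j) * exp (- (cmod q ^ j - Re (q ^ j)) / 4)"
      by (simp add: norm_power)
  qed simp
  also have "\<dots> = (\<Prod>j=1..N. 1 + cmod q ^ j) * exp (- (\<Sum>j=1..N. cmod q ^ j - Re (q ^ j)) / 4)"
    by (simp add: prod.distrib exp_sum sum_divide_distrib sum_negf[symmetric])
  also have "(\<Prod>j=1..N. 1 + cmod q ^ j) = cmod (\<Prod>j=1..N. 1 + of_real (cmod q ^ j))"
    unfolding prod_norm[symmetric]
  proof (rule prod.cong[OF refl])
    fix j
    have "1 + of_real (cmod q ^ j) = (of_real (1 + cmod q ^ j) :: complex)" by simp
    moreover have "1 + cmod q ^ j \<ge> 0" by simp
    ultimately show "1 + cmod q ^ j = cmod (1 + of_real (cmod q ^ j))" by (metis norm_of_real abs_of_nonneg)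
  qed
  finally show ?thesis unfolding expq expr q_def .
qed

text \<open>The limit of the bound for finite products: the defects \<open>|q|^j - Re (q^j)\<close>
  sum to a difference of two geometric series.\<close>

lemma norm_exp_log_gf_le:
  assumes "Re \<tau> > 0"
  defines "q \<equiv> exp (-\<tau>)"
  shows "cmod (exp (log_gf \<tau>)) \<le> cmod (exp (log_gf (of_real (Re \<tau>)))) *
    exp (- (cmod q / (1 - cmod q) - Re (q / (1 - q))) / 4)"
proof (rule LIMSEQ_le)
  have r1: "cmod q < 1" using assms by simp
  show "(\<lambda>N. cmod (\<Prod>j=1..N. (1 + exp (- (of_nat j * \<tau>))))) \<longlonglongrightarrow> cmod (exp (log_gf \<tau>))"
    by (intro tendsto_norm gf_prod_tendsto assms)
  have geom: "(\<lambda>N. \<Sum>j=1..N. x ^ j) \<longlonglongrightarrow> x / (1 - x)" if "norm x < 1" for x :: "'b :: {real_normed_field,banach}"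
  proof -
    have "(\<lambda>n. x * x ^ n) sums (x * (1 / (1 - x)))"
      using that by (intro sums_mult geometric_sums)
    thus ?thesis unfolding sums_def
      by (simp add: sum.atLeast1_atMost_eq)
  qed
  show "(\<lambda>N. cmod (\<Prod>j=1..N. (1 + exp (- (of_nat j * of_real (Re \<tau>))))) *
    exp (- (\<Sum>j=1..N. cmod q ^ j - Re (q ^ j)) / 4)) \<longlonglongrightarrow> 
     cmod (exp (log_gf (of_real (Re \<tau>)))) * exp (- (cmod q / (1 - cmod q) - Re (q / (1 - q))) / 4)"
    unfolding sum_subtractf Re_sum[symmetric]
    by (intro tendsto_intros gf_prod_tendsto geom) (use assms r1 in auto)
  show "\<exists>N. \<forall>n\<ge>N. cmod (\<Prod>j=1..n. (1 + exp (- (of_nat j * \<tau>)))) \<le> cmod (\<Prod>j=1..n. (1 + exp (- (of_nat j * of_real (Re \<tau>))))) *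
    exp (- (\<Sum>j=1..n. cmod q ^ j - Re (q ^ j)) / 4)"
    using norm_gf_prod_le[OF assms(1)] unfolding q_def by blast
qed

section \<open>Explicit decay away from the real axis\<close>

lemma sin_ge_chord:
  assumes "0 \<le> x" "x \<le> pi / 2"
  shows "sin x \<ge> 2 / pi * x"
proof -
  \<comment> \<open>Jordan's inequality: sine is concave on this interval, so it lies above its
    chord.\<close>
  have c: "convex_on {0..pi/2} (\<lambda>x. - sin x)"
  proof (rule f''_ge0_imp_convex)
    show "((\<lambda>x. - sin x) has_real_derivative - cos x) (at x)" for x
      by (auto intro!: derivative_eq_intros)
    show "((\<lambda>x. - cos x) has_real_derivative sin x) (at x)" for x
      by (auto intro!: derivative_eq_intros)
    show "sin x \<ge> 0" if "x \<in> {0..pi/2}" for x using that by (intro sin_ge_zero) auto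
  qed auto
  define u where "u = 2 / pi * x"
  have u: "0 \<le> u" "u \<le> 1" "x = u * (pi / 2)" unfolding u_def using assms by (auto simp: field_simps)
  have "- sin ((1 - u) *\<^sub>R 0 + u *\<^sub>R (pi / 2)) \<le> (1 - u) * (- sin 0) + u * (- sin (pi / 2))"
    using u by (intro convex_onD[OF c]) auto
  hence "- sin (u * (pi / 2)) \<le> - u" by simp
  hence "- sin x \<le> - u" by (simp only: u(3)[symmetric])
  thus ?thesis by (simp add: u_def)
qed

text \<open>Write \<open>1 - cos \<theta>\<close> as twice the square of the sine of the half angle,
  and use \<open>sin x \<ge> x / 2\<close>, which follows from \<open>pi < 4\<close>. This gives
  \<theta>^2 / 8.\<close>

lemma one_minus_cos_ge:
  assumes "\<bar>\<theta>\<bar> \<le> pi"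
  shows "1 - cos \<theta> \<ge> \<theta>\<^sup>2 / 10"
proof -
  define x where "x = \<bar>\<theta>\<bar> / 2"
  have x: "0 \<le> x" "x \<le> pi / 2" unfolding x_def using assms by auto
  have "x / 2 \<le> 2 / pi * x"
  proof -
    have "1 / 2 \<le> 2 / pi" using pi_less_4 by (simp add: field_simps)
    thus ?thesis using x mult_right_mono[of "1/2" "2/pi" x] by simp
  qed
  also have "\<dots> \<le> sin x" by (rule sin_ge_chord[OF x])
  finally have s: "x / 2 \<le> sin x" .
  hence "(x / 2)\<^sup>2 \<le> (sin x)\<^sup>2" using x by (intro power_mono) auto
  moreover have "cos \<theta> = 1 - 2 * (sin x)\<^sup>2"
    using cos_double_sin[of x] unfolding x_def by simp
  ultimately have "1 - cos \<theta> \<ge> 2 * (x / 2)\<^sup>2" by linarith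
  also have "2 * (x / 2)\<^sup>2 = \<theta>\<^sup>2 / 8" unfolding x_def by (simp add: power_divide)
  finally show ?thesis using zero_le_power2[of \<theta>] by linarith
qed

text \<open>With \<open>a = 1 - |q|\<close> and \<open>y = |q| * (1 - cos \<theta>)\<close> one has
  \<open>|1 - q|^2 = a^2 + 2 * y\<close> and \<open>Re (1 - q) = a + y\<close>, so the defect equals
  \<open>(2 - a) * y / (a * (a^2 + 2 * y))\<close>. Then \<open>a \<le> t\<close> and
  \<open>y \<ge> \<theta>^2 / 20\<close> finish.\<close>

lemma geometric_defect_ge:
  assumes "0 < t" "t \<le> 1 / 2" "\<bar>\<theta>\<bar> \<le> pi"
  defines "q \<equiv> exp (- Complex t \<theta>)"
  shows "cmod q / (1 - cmod q) - Re (q / (1 - q)) \<ge> \<theta>\<^sup>2 / (t * (20 * t\<^sup>2 + 2 * \<theta>\<^sup>2))"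
proof -
  define r where "r = exp (-t)"
  define a where "a = 1 - r"
  define w where "w = 1 - cos \<theta>"
  define y where "y = r * w"
  have rhalf: "r \<ge> 1 / 2" using exp_ge_add_one_self[of "-t"] assms unfolding r_def by linarith
  have r1: "r < 1" unfolding r_def using assms by simp
  have a: "0 < a" "a \<le> t" using r1 exp_ge_add_one_self[of "-t"] unfolding a_def r_def by auto
  have w: "w \<ge> \<theta>\<^sup>2 / 10" unfolding w_def using assms by (intro one_minus_cos_ge) auto
  have "(1 / 2) * (\<theta>\<^sup>2 / 10) \<le> y"
    unfolding y_def using w rhalf by (intro mult_mono) auto
  hence y: "\<theta>\<^sup>2 / 20 \<le> y" by simp
  have y0: "0 \<le> y" using y zero_le_power2[of \<theta>] by linarith
  have qr: "cmod q = r" unfolding q_def r_def by simp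
  have req: "Re q = r * cos \<theta>" "Im q = - r * sin \<theta>" unfolding q_def r_def by (auto simp: Re_exp Im_exp)
  have qn1: "q \<noteq> 1" using qr r1 by auto
  have den: "(Re (1 - q))\<^sup>2 + (Im (1 - q))\<^sup>2 = a\<^sup>2 + 2 * y"
  proof -
    have id: "(1 - r * c)\<^sup>2 + (r * s)\<^sup>2 = 1 - 2 * r * c + r\<^sup>2 * (s\<^sup>2 + c\<^sup>2)" for c s
      by (simp add: power2_eq_square algebra_simps)
    have "Re (1 - q) = 1 - r * cos \<theta>" "Im (1 - q) = r * sin \<theta>" by (auto simp: req)
    hence "(Re (1 - q))\<^sup>2 + (Im (1 - q))\<^sup>2 = 1 - 2 * r * cos \<theta> + r\<^sup>2 * ((sin \<theta>)\<^sup>2 + (cos \<theta>)\<^sup>2)"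
      by (simp only: id)
    also have "\<dots> = a\<^sup>2 + 2 * y" unfolding a_def y_def w_def sin_cos_squared_add
      by (simp add: power2_eq_square algebra_simps)
    finally show ?thesis .
  qed
  have "q / (1 - q) = 1 / (1 - q) - 1" using qn1 by (simp add: field_simps)
  hence "Re (q / (1 - q)) = Re (1 - q) / (a\<^sup>2 + 2 * y) - 1"
    unfolding den[symmetric] by (simp add: Re_divide)
  also have "Re (1 - q) = a + y" by (simp add: req a_def y_def w_def algebra_simps)
  finally have R: "Re (q / (1 - q)) = (a + y) / (a\<^sup>2 + 2 * y) - 1" .
  have L: "cmod q / (1 - cmod q) = 1 / a - 1" unfolding qr a_def using r1 by (simp add: field_simps)
  have dpos: "a\<^sup>2 + 2 * y > 0" using a y0 by (simp add: add_pos_nonneg)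
  have "1 / a - (a + y) / (a\<^sup>2 + 2 * y) = (1 / a) * ((2 - a) * y / (a\<^sup>2 + 2 * y))"
    using a dpos by (simp add: divide_simps) (simp add: power2_eq_square algebra_simps)
  also have "\<dots> \<ge> (1 / t) * (y / (t\<^sup>2 + 2 * y))"
  proof (intro mult_mono frac_le)
    show "a\<^sup>2 + 2 * y \<le> t\<^sup>2 + 2 * y" using a by (intro add_right_mono power_mono) auto
    have "1 * y \<le> (2 - a) * y" using a assms y0 by (intro mult_right_mono) auto
    thus "y \<le> (2 - a) * y" by simp
    show "0 \<le> (2 - a) * y" using a assms y0 by simp
  qed (use a y0 dpos assms in auto)
  finally have A: "(1 / t) * (y / (t\<^sup>2 + 2 * y)) \<le> 1 / a - (a + y) / (a\<^sup>2 + 2 * y)" .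
  \<comment> \<open>The quotient \<open>y / (t^2 + 2 * y)\<close> increases with \<open>y\<close>,
    so the lower bound for \<open>y\<close> may be inserted.\<close>
  have "y / (t\<^sup>2 + 2 * y) \<ge> (\<theta>\<^sup>2 / 20) / (t\<^sup>2 + 2 * (\<theta>\<^sup>2 / 20))"
  proof -
    have "(\<theta>\<^sup>2 / 20) * t\<^sup>2 \<le> y * t\<^sup>2" using y by (intro mult_right_mono) auto
    hence num: "\<theta>\<^sup>2 / 20 * (t\<^sup>2 + 2 * y) - y * (t\<^sup>2 + 2 * (\<theta>\<^sup>2 / 20)) \<le> 0" by (simp add: algebra_simps)
    have pos: "t\<^sup>2 + 2 * y > 0" "t\<^sup>2 + 2 * (\<theta>\<^sup>2 / 20) > 0" using y0 assms by (auto intro!: add_pos_nonneg)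
    show ?thesis
      by (rule iffD2[OF frac_le_eq divide_nonpos_pos[OF num mult_pos_pos[OF pos(2,1)]]]) (use pos in linarith)+
  qed
  hence "(1 / t) * ((\<theta>\<^sup>2 / 20) / (t\<^sup>2 + 2 * (\<theta>\<^sup>2 / 20))) \<le> (1 / t) * (y / (t\<^sup>2 + 2 * y))"
    using assms(1) by (intro mult_left_mono) auto
  also note A
  also have "(1 / t) * ((\<theta>\<^sup>2 / 20) / (t\<^sup>2 + 2 * (\<theta>\<^sup>2 / 20))) = \<theta>\<^sup>2 / (t * (20 * t\<^sup>2 + 2 * \<theta>\<^sup>2))"
  proof -
    have "20 * t\<^sup>2 + 2 * \<theta>\<^sup>2 = 20 * (t\<^sup>2 + 2 * (\<theta>\<^sup>2 / 20))" by simp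
    thus ?thesis by (simp only: ) simp
  qed
  finally show ?thesis unfolding L R by simp
qed

lemma exp_minus_le_inverse_cube:
  fixes y :: real
  assumes "y > 0"
  shows "exp (- y) \<le> 27 / y ^ 3"
proof -
  have "(y / 3) ^ 3 \<le> exp (y / 3) ^ 3"
    using exp_ge_add_one_self[of "y / 3"] assms by (intro power_mono) linarith+
  also have "\<dots> = exp y" by (simp flip: exp_of_nat_mult)
  finally have "y ^ 3 \<le> 27 * exp y" by (simp add: power_divide)
  thus ?thesis using assms by (simp add: exp_minus field_simps)
qed

text \<open>After cancelling \<open>t ^ 3\<close> the defect is
  \<open>x^2 / (20 + 2 * x^2 * t)\<close>. If \<open>x^2 * t \<le> 1\<close>, it is at least
  \<open>x^2 / 22\<close>, and \<open>exp (- u) \<le> 1 / (1 + u)\<close> suffices. Otherwise it is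
  at least \<open>1 / (22 * t)\<close>, and the exponential is of order \<open>t ^ 3\<close>, which
  is at most \<open>11 / (1 + x^2)\<close>.\<close>

lemma defect_majorant:
  fixes t x :: real
  assumes "0 < t" "t \<le> 1 / 2" and xpi: "x\<^sup>2 * t ^ 3 \<le> 10"
  shows "exp (- (x\<^sup>2 * t ^ 3 / (t * (20 * t\<^sup>2 + 2 * (x\<^sup>2 * t ^ 3)))) / 4) \<le> 3 * 10 ^ 8 / (1 + x\<^sup>2)"
proof -
  have eq: "x\<^sup>2 * t ^ 3 / (t * (20 * t\<^sup>2 + 2 * (x\<^sup>2 * t ^ 3))) = x\<^sup>2 / (20 + 2 * (x\<^sup>2 * t))"
  proof -
    have "t * (20 * t\<^sup>2 + 2 * (x\<^sup>2 * t ^ 3)) = (20 + 2 * (x\<^sup>2 * t)) * t ^ 3"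
      by (simp add: algebra_simps power2_eq_square power3_eq_cube)
    thus ?thesis using assms by simp
  qed
  show ?thesis
  proof (cases "x\<^sup>2 * t \<le> 1")
    case True
    have aux: "A / 22 \<le> Z \<Longrightarrow> - Z / 4 \<le> - (A / 88)" for A Z :: real by linarith
    have "x\<^sup>2 / (20 + 2 * (x\<^sup>2 * t)) \<ge> x\<^sup>2 / 22" using True assms by (intro divide_left_mono) (auto intro!: add_pos_nonneg mult_pos_pos)
    hence "exp (- (x\<^sup>2 * t ^ 3 / (t * (20 * t\<^sup>2 + 2 * (x\<^sup>2 * t ^ 3)))) / 4) \<le> exp (- (x\<^sup>2 / 88))"
      unfolding eq exp_le_cancel_iff by (rule aux)
    also have "\<dots> \<le> 1 / (1 + x\<^sup>2 / 88)"
      using exp_ge_add_one_self[of "x\<^sup>2 / 88"] unfolding exp_minus inverse_eq_divide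
      by (intro divide_left_mono mult_pos_pos) (auto intro: add_pos_nonneg)
    also have "\<dots> \<le> 3 * 10 ^ 8 / (1 + x\<^sup>2)"
      by (simp add: divide_simps add_pos_nonneg)
    finally show ?thesis .
  next
    case False
    have xt: "x\<^sup>2 * t \<ge> 1" using False by simp
    have xpos: "x\<^sup>2 > 0" using False by (cases "x = 0") auto
    have "x\<^sup>2 / (20 + 2 * (x\<^sup>2 * t)) \<ge> x\<^sup>2 / (22 * (x\<^sup>2 * t))"
      using xt xpos assms by (intro divide_left_mono mult_pos_pos) (linarith, auto intro!: add_pos_nonneg)
    also have "x\<^sup>2 / (22 * (x\<^sup>2 * t)) = 1 / (22 * t)" using assms xpos by simp
    also have "1 / (22 * t) = 4 * (1 / (88 * t))" by simp
    finally have *: "4 * (1 / (88 * t)) \<le> x\<^sup>2 / (20 + 2 * (x\<^sup>2 * t))" .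
    have aux: "4 * A \<le> Z \<Longrightarrow> - Z / 4 \<le> - A" for A Z :: real by linarith
    from * have "exp (- (x\<^sup>2 * t ^ 3 / (t * (20 * t\<^sup>2 + 2 * (x\<^sup>2 * t ^ 3)))) / 4) \<le> exp (- (1 / (88 * t)))"
      unfolding eq exp_le_cancel_iff by (rule aux)
    also have "\<dots> \<le> 27 / (1 / (88 * t)) ^ 3"
      using assms by (intro exp_minus_le_inverse_cube) auto
    also have "\<dots> = 27 * 88 ^ 3 * t ^ 3" by (simp add: power_divide power_mult_distrib)
    also have "\<dots> \<le> 27 * 88 ^ 3 * (11 / (1 + x\<^sup>2))"
    proof -
      have "t ^ 3 \<le> 1 ^ 3" using assms by (intro power_mono) auto
      hence "t ^ 3 * (1 + x\<^sup>2) \<le> 11" using xpi by (simp add: algebra_simps)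
      hence "t ^ 3 \<le> 11 / (1 + x\<^sup>2)" by (subst pos_le_divide_eq) (auto intro: add_pos_nonneg)
      thus ?thesis by (intro mult_left_mono) auto
    qed
    also have "\<dots> \<le> 3 * 10 ^ 8 / (1 + x\<^sup>2)"
      using xpos by (simp add: divide_simps)
    finally show ?thesis .
  qed
qed

text \<open>On the scale \<open>\<theta> = x * t powr (3/2)\<close> the damping factor has a
  majorant independent of \<open>t\<close> and integrable in \<open>x\<close>. The range of
  \<open>x\<close> means \<open>|\<theta>| \<le> pi\<close>, and \<open>pi^2 < 10\<close> supplies
  the assumption of \<open>defect_majorant\<close>.\<close>

lemma norm_exp_log_gf_majorant:
  assumes "0 < t" "t \<le> 1 / 2" "\<bar>x\<bar> * t powr (3/2) \<le> pi"
  shows "cmod (exp (log_gf (Complex t (x * t powr (3/2))))) \<le> cmod (exp (log_gf (of_real t))) * (3 * 10 ^ 8 / (1 + x\<^sup>2))"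
proof -
  define \<theta> where "\<theta> = x * t powr (3/2)"
  define q where "q = exp (- Complex t \<theta>)"
  have \<theta>: "\<bar>\<theta>\<bar> \<le> pi" using assms by (simp add: \<theta>_def abs_mult)
  have "(t powr (3/2))\<^sup>2 = t powr (3/2 + 3/2)" unfolding power2_eq_square by (rule powr_add[symmetric])
  hence "(t powr (3/2))\<^sup>2 = t ^ 3" using assms by (simp add: powr_numeral)
  hence \<theta>2: "\<theta>\<^sup>2 = x\<^sup>2 * t ^ 3" unfolding \<theta>_def by (simp add: power_mult_distrib)
  have "\<theta>\<^sup>2 \<le> pi\<^sup>2" using \<theta> by (simp add: abs_le_square_iff[symmetric])
  also have "pi\<^sup>2 \<le> 3.15\<^sup>2" using pi_approx by (intro power_mono) auto
  finally have \<theta>10: "x\<^sup>2 * t ^ 3 \<le> 10" unfolding \<theta>2 by (simp add: power2_eq_square)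
  have "cmod (exp (log_gf (Complex t \<theta>))) \<le> cmod (exp (log_gf (of_real t))) *
    exp (- (cmod q / (1 - cmod q) - Re (q / (1 - q))) / 4)"
    unfolding q_def using norm_exp_log_gf_le[of "Complex t \<theta>"] assms by simp
  also have "\<dots> \<le> cmod (exp (log_gf (of_real t))) * (3 * 10 ^ 8 / (1 + x\<^sup>2))"
  proof (rule mult_left_mono)
    have "exp (- (cmod q / (1 - cmod q) - Re (q / (1 - q))) / 4) \<le> exp (- (\<theta>\<^sup>2 / (t * (20 * t\<^sup>2 + 2 * \<theta>\<^sup>2))) / 4)"
      using geometric_defect_ge[OF assms(1,2) \<theta>] unfolding q_def by simp
    also have "\<dots> \<le> 3 * 10 ^ 8 / (1 + x\<^sup>2)"
      unfolding \<theta>2 by (rule defect_majorant[OF assms(1,2) \<theta>10])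
    finally show "exp (- (cmod q / (1 - cmod q) - Re (q / (1 - q))) / 4) \<le> 3 * 10 ^ 8 / (1 + x\<^sup>2)" .
  qed simp
  finally show ?thesis unfolding \<theta>_def .
qed

section \<open>The saddle point method\<close>

lemma integral_exp_vertical_period:
  fixes t :: real and m :: int
  shows "(LINT \<theta>|lborel. indicator {-pi..pi} \<theta> *\<^sub>R exp (of_int m * Complex t \<theta>)) = (if m = 0 then 2 * pi else 0)"
proof -
  have Ce: "Complex t \<theta> = of_real t + \<i> * of_real \<theta>" for \<theta> by (simp add: complex_eq_iff)
  have cont: "continuous_on {-pi..pi} (\<lambda>\<theta>. exp (of_int m * Complex t \<theta>))"
    unfolding Ce by (intro continuous_intros)
  show ?thesis
  proof (cases "m = 0")
    case True
    have "(LINT \<theta>|lborel. indicator {-pi..pi} \<theta> *\<^sub>R (1::complex)) = of_real pi - of_real (-pi)"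
      by (rule integral_FTC_atLeastAtMost) (auto intro!: derivative_eq_intros continuous_intros simp: has_vector_derivative_def scaleR_conv_of_real)
    thus ?thesis using True by simp
  next
    case False
    define F where "F = (\<lambda>\<theta>. exp (of_int m * Complex t \<theta>) / (\<i> * of_int m))"
    have "(LINT \<theta>|lborel. indicator {-pi..pi} \<theta> *\<^sub>R exp (of_int m * Complex t \<theta>)) = F pi - F (-pi)"
    proof (rule integral_FTC_atLeastAtMost)
      fix x assume "-pi \<le> x" "x \<le> pi"
      have "((\<lambda>z. exp (of_int m * (of_real t + \<i> * z)) / (\<i> * of_int m)) has_field_derivative 
           exp (of_int m * (of_real t + \<i> * of_real x))) (at (of_real x))"
        by (auto intro!: derivative_eq_intros simp: False field_simps)
      from has_vector_derivative_real_field[OF this]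
      show "(F has_vector_derivative exp (of_int m * Complex t x)) (at x within {-pi..pi})"
        unfolding F_def Ce .
    qed (use cont in auto)
    \<comment> \<open>The antiderivative has period \<open>2 * pi\<close> because \<open>m\<close>
      is an integer.\<close>
    also have "F pi = F (-pi)"
    proof -
      have "of_int m * Complex t pi = of_int m * Complex t (-pi) + 2 * pi * of_int m * \<i>"
        unfolding Ce by (simp add: algebra_simps)
      hence "exp (of_int m * Complex t pi) = exp (of_int m * Complex t (-pi)) * exp (of_real (2 * pi * of_int m) * \<i>)"
        by (simp add: exp_add)
      also have "exp (of_real (2 * pi * of_int m) * \<i>) = 1"
        using exp_integer_2pi[of "of_int m"] by (simp add: mult_ac)
      finally show ?thesis unfolding F_def by simp
    qed
    finally show ?thesis using False by simp
  qed
qed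

lemma gf_prod_expand:
  "(\<Prod>j=1..N. (1 + exp (- (of_nat j * \<tau>)))) = (\<Sum>S\<in>Pow {1..N}. exp (- (of_nat (\<Sum>S) * \<tau> :: complex)))"
proof -
  have "(\<Prod>j=1..N. (1 + exp (- (of_nat j * \<tau>)))) = (\<Prod>j=1..N. (exp (- (of_nat j * \<tau>)) + 1))"
    by (simp add: add.commute)
  also have "\<dots> = (\<Sum>S\<in>Pow {1..N}. (\<Prod>j\<in>S. exp (- (of_nat j * \<tau>))))"
    by (subst prod_add) simp_all
  also have "\<dots> = (\<Sum>S\<in>Pow {1..N}. exp (- (of_nat (\<Sum>S) * \<tau> :: complex)))"
  proof (rule sum.cong[OF refl])
    fix S assume "S \<in> Pow {1..N}"
    hence "finite S" using finite_subset by auto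
    hence "(\<Prod>j\<in>S. exp (- (of_nat j * \<tau>))) = exp (\<Sum>j\<in>S. - (of_nat j * \<tau>))" by (rule exp_sum[symmetric])
    thus "(\<Prod>j\<in>S. exp (- (of_nat j * \<tau>))) = exp (- (of_nat (\<Sum>S) * \<tau>))"
      by (simp add: sum_negf sum_distrib_right)
  qed
  finally show ?thesis .
qed

text \<open>Orthogonality keeps only the sets with sum \<open>n\<close> in the expanded product.
  Since \<open>n \<le> N\<close>, no partition of \<open>n\<close> has a part beyond the
  product.\<close>

lemma integral_gf_prod:
  assumes "n \<le> N"
  shows "(LINT \<theta>|lborel. indicator {-pi..pi} \<theta> *\<^sub>R (exp (of_nat n * Complex t \<theta>) * 
       (\<Prod>j=1..N. (1 + exp (- (of_nat j * Complex t \<theta>)))))) = of_real (2 * pi * card (distinct_parts 0 n))"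
proof -
  have Ce: "Complex t \<theta> = of_real t + \<i> * of_real \<theta>" for \<theta> by (simp add: complex_eq_iff)
  have "(LINT \<theta>|lborel. indicator {-pi..pi} \<theta> *\<^sub>R (exp (of_nat n * Complex t \<theta>) * 
       (\<Prod>j=1..N. (1 + exp (- (of_nat j * Complex t \<theta>)))))) = 
     (LINT \<theta>|lborel. (\<Sum>S\<in>Pow {1..N}. indicator {-pi..pi} \<theta> *\<^sub>R exp (of_int (int n - int (\<Sum>S)) * Complex t \<theta>)))"
    unfolding gf_prod_expand
    by (simp add: sum_distrib_left scaleR_sum_right exp_add[symmetric] algebra_simps)
  also have "\<dots> = (\<Sum>S\<in>Pow {1..N}. LINT \<theta>|lborel. indicator {-pi..pi} \<theta> *\<^sub>R exp (of_int (int n - int (\<Sum>S)) * Complex t \<theta>))"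
    by (rule Bochner_Integration.integral_sum) (auto simp: Ce intro!: borel_integrable_compact continuous_intros)
  also have "\<dots> = (\<Sum>S\<in>Pow {1..N}. if \<Sum>S = n then of_real (2 * pi) else 0)"
    unfolding integral_exp_vertical_period by (intro sum.cong) (auto simp del: of_nat_sum)
  also have "\<dots> = (\<Sum>S\<in>{S\<in>Pow {1..N}. \<Sum>S = n}. of_real (2 * pi))"
    by (rule sum.inter_filter[symmetric]) simp
  also have "{S\<in>Pow {1..N}. \<Sum>S = n} = distinct_parts 0 n"
  proof
    show "{S\<in>Pow {1..N}. \<Sum>S = n} \<subseteq> distinct_parts 0 n"
      unfolding distinct_parts_def using finite_subset by fastforce
    have "S \<in> Pow {1..N}" if "S \<in> distinct_parts 0 n" for S
      using distinct_parts_subset[of 0 n] that assms by fastforce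
    thus "distinct_parts 0 n \<subseteq> {S\<in>Pow {1..N}. \<Sum>S = n}" unfolding distinct_parts_def by auto
  qed
  finally show ?thesis by simp
qed

lemma borel_measurable_Complex [measurable]:
  assumes [measurable]: "f \<in> borel_measurable M" "g \<in> borel_measurable M"
  shows "(\<lambda>x. Complex (f x) (g x)) \<in> borel_measurable M"
proof -
  have "(\<lambda>x. complex_of_real (f x) + \<i> * complex_of_real (g x)) \<in> borel_measurable M" by measurable
  thus ?thesis by (simp add: Complex_eq)
qed

lemma borel_measurable_log_gf [measurable]: "log_gf \<in> borel_measurable borel"
  unfolding log_gf_def by measurable

text \<open>The formula for finite products does not change once \<open>N \<ge> n\<close>, and
  \<open>N\<close> tends to infinity under the integral: on the vertical line the products are
  dominated by those at the real point \<open>t\<close>, which converge and are therefore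
  bounded.\<close>

lemma card_distinct_parts_integral:
  assumes "t > 0"
  shows "(LINT \<theta>|lborel. indicator {-pi..pi} \<theta> *\<^sub>R exp (of_nat n * Complex t \<theta> + log_gf (Complex t \<theta>))) = 
         of_real (2 * pi * card (distinct_parts 0 n))"
proof -
  define P where "P = (\<lambda>N \<tau>. \<Prod>j=1..N. (1 + exp (- (of_nat j * \<tau> :: complex))))"
  have "convergent (\<lambda>N. P N (of_real t))"
    using gf_prod_tendsto[of "of_real t"] assms unfolding P_def convergent_def by auto
  hence "Bseq (\<lambda>N. P N (of_real t))" by (rule convergent_imp_Bseq)
  then obtain K where K: "\<And>N. cmod (P N (of_real t)) \<le> K" by (auto simp: Bseq_def)
  have bd: "cmod (P N (Complex t \<theta>)) \<le> K" for N \<theta>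
  proof -
    have "cmod (P N (Complex t \<theta>)) \<le> cmod (P N (of_real t)) * 
       exp (- (\<Sum>j=1..N. cmod (exp (-Complex t \<theta>)) ^ j - Re (exp (-Complex t \<theta>) ^ j)) / 4)"
      using norm_gf_prod_le[of "Complex t \<theta>" N] assms unfolding P_def by simp
    also have "\<dots> \<le> cmod (P N (of_real t)) * 1"
    proof (intro mult_left_mono)
      have "0 \<le> (\<Sum>j=1..N. cmod (exp (-Complex t \<theta>)) ^ j - Re (exp (-Complex t \<theta>) ^ j))"
        by (intro sum_nonneg) (metis complex_Re_le_cmod norm_power diff_ge_0_iff_ge)
      thus "exp (- (\<Sum>j=1..N. cmod (exp (-Complex t \<theta>)) ^ j - Re (exp (-Complex t \<theta>) ^ j)) / 4) \<le> 1" by simp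
    qed simp
    also have "\<dots> \<le> K" using K by simp
    finally show ?thesis .
  qed
  have "(\<lambda>N. LINT \<theta>|lborel. indicator {-pi..pi} \<theta> *\<^sub>R (exp (of_nat n * Complex t \<theta>) * P N (Complex t \<theta>)))
     \<longlonglongrightarrow> (LINT \<theta>|lborel. indicator {-pi..pi} \<theta> *\<^sub>R exp (of_nat n * Complex t \<theta> + log_gf (Complex t \<theta>)))"
  proof (rule integral_dominated_convergence[where w = "\<lambda>\<theta>. indicator {-pi..pi} \<theta> *\<^sub>R (exp (real n * t) * K)"])
    show "(\<lambda>\<theta>. indicator {-pi..pi} \<theta> *\<^sub>R exp (of_nat n * Complex t \<theta> + log_gf (Complex t \<theta>))) \<in> borel_measurable lborel"
      by measurable
    show "(\<lambda>\<theta>. indicator {-pi..pi} \<theta> *\<^sub>R (exp (of_nat n * Complex t \<theta>) * P N (Complex t \<theta>))) \<in> borel_measurable lborel" for N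
      unfolding P_def by measurable
    show "integrable lborel (\<lambda>\<theta>. indicator {-pi..pi} \<theta> *\<^sub>R (exp (real n * t) * K))"
      by (rule borel_integrable_compact) auto
    show "AE \<theta> in lborel. (\<lambda>N. indicator {-pi..pi} \<theta> *\<^sub>R (exp (of_nat n * Complex t \<theta>) * P N (Complex t \<theta>)))
       \<longlonglongrightarrow> indicator {-pi..pi} \<theta> *\<^sub>R exp (of_nat n * Complex t \<theta> + log_gf (Complex t \<theta>))"
      unfolding P_def exp_add by (intro AE_I2 tendsto_intros gf_prod_tendsto) (use assms in auto)
    show "AE \<theta> in lborel. norm (indicator {-pi..pi} \<theta> *\<^sub>R (exp (of_nat n * Complex t \<theta>) * P N (Complex t \<theta>)))
       \<le> indicator {-pi..pi} \<theta> *\<^sub>R (exp (real n * t) * K)" for N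
      by (intro AE_I2) (auto simp: indicator_def norm_mult intro!: mult_left_mono bd)
  qed
  moreover have "eventually (\<lambda>N. (LINT \<theta>|lborel. indicator {-pi..pi} \<theta> *\<^sub>R (exp (of_nat n * Complex t \<theta>) * P N (Complex t \<theta>)))
      = of_real (2 * pi * card (distinct_parts 0 n))) sequentially"
    using eventually_ge_at_top[of n] unfolding P_def by eventually_elim (rule integral_gf_prod)
  ultimately show ?thesis
    by (intro LIMSEQ_unique[OF _ tendsto_eventually])
qed

section \<open>The Gaussian limit at the saddle point\<close>

lemma integrable_inverse_one_plus_square: "integrable lborel (\<lambda>x::real. 1 / (1 + x\<^sup>2))"
  using integrable_inverse_1_plus_square
  by (simp add: set_integrable_def einterval_def inverse_eq_divide)

text \<open>The integrand is a multiple of the centred normal density with variance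
  \<open>1 / (2 * a)\<close>.\<close>

lemma integral_gaussian:
  assumes "a > 0"
  shows "integrable lborel (\<lambda>x::real. exp (- a * x\<^sup>2))" "(LINT x|lborel. exp (- a * x\<^sup>2)) = sqrt (pi / a)"
proof -
  define \<sigma> where "\<sigma> = sqrt (1 / (2 * a))"
  have \<sigma>: "\<sigma> > 0" "\<sigma>\<^sup>2 = 1 / (2 * a)" unfolding \<sigma>_def using assms by auto
  have eq: "exp (- a * x\<^sup>2) = sqrt (pi / a) * normal_density 0 \<sigma> x" for x
    unfolding normal_density_def \<sigma>(2) using assms by (simp add: real_sqrt_divide field_simps)
  show "integrable lborel (\<lambda>x::real. exp (- a * x\<^sup>2))" unfolding eq using \<sigma> by simp
  show "(LINT x|lborel. exp (- a * x\<^sup>2)) = sqrt (pi / a)" unfolding eq using \<sigma> by simp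
qed

text \<open>
  The exponent \<open>\<nu> * \<tau> + pi\<^sup>2 / (12 * \<tau>)\<close> has its saddle point at \<open>t\<close>, where the scale
  \<open>t powr (3/2)\<close> in the imaginary direction makes the quadratic term independent of \<open>t\<close>.
\<close>
lemma saddle_point_expansion:
  fixes t x \<nu> C :: real
  assumes C: "\<And>\<tau>. Re \<tau> > 0 \<Longrightarrow> \<bar>Im \<tau>\<bar> \<le> Re \<tau> \<Longrightarrow>
     cmod (log_gf \<tau> - of_real (pi\<^sup>2 / 12) / \<tau> + of_real (ln 2 / 2)) \<le> C * sqrt (cmod \<tau>)"
  assumes t: "t > 0" and \<nu>: "\<nu> = pi\<^sup>2 / (12 * t\<^sup>2)" and x: "\<bar>x\<bar> * sqrt t \<le> 1"
  defines "\<tau> \<equiv> Complex t (x * t powr (3/2))"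
  shows "cmod (of_real \<nu> * \<tau> + log_gf \<tau> - of_real (pi\<^sup>2 / (6 * t) - ln 2 / 2)
           + of_real (pi\<^sup>2 / 12 * x\<^sup>2) / (1 + \<i> * of_real (sqrt t * x))) \<le> \<bar>C\<bar> * sqrt (2 * t)"
proof -
  \<comment> \<open>With \<open>\<tau> = t * w\<close> the main exponent is
    \<open>pi^2 / (12 * t) * (w + 1 / w)\<close>, and
    \<open>w + 1 / w - 2 = (w - 1)^2 / w = - t * x^2 / w\<close>, so the powers of \<open>t\<close>
    cancel.\<close>
  define w where "w = 1 + \<i> * of_real (sqrt t * x)"
  have t32: "t powr (3/2) = t * sqrt t"
    using t powr_add[of t 1 "1/2"] by (simp add: powr_half_sqrt)
  have \<tau>: "\<tau> = of_real t * w"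
    unfolding \<tau>_def w_def t32 by (simp add: complex_eq_iff)
  have Re: "Re \<tau> = t" and Im: "Im \<tau> = x * sqrt t * t" unfolding \<tau>_def t32 by auto
  have Im_le: "\<bar>Im \<tau>\<bar> \<le> t"
    unfolding Im abs_mult using mult_right_mono[OF x, of t] t by (simp add: abs_mult)
  have norm\<tau>: "cmod \<tau> \<le> 2 * t" using cmod_le[of \<tau>] Im_le Re t by simp
  have wnz: "w \<noteq> 0" unfolding w_def by (simp add: complex_eq_iff)
  have tnz: "complex_of_real t \<noteq> 0" using t by simp
  have "w\<^sup>2 + 1 - 2 * w + of_real (t * x\<^sup>2) = (w - 1)\<^sup>2 + of_real (t * x\<^sup>2)"
    by (simp add: power2_eq_square algebra_simps)
  also have "(w - 1)\<^sup>2 = - of_real ((sqrt t)\<^sup>2 * x\<^sup>2)" unfolding w_def by (simp add: power_mult_distrib)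
  also have "(sqrt t)\<^sup>2 = t" using t by simp
  finally have key: "w\<^sup>2 + 1 - 2 * w + of_real t * of_real x ^ 2 = 0" by simp
  have "of_real \<nu> * \<tau> + of_real (pi\<^sup>2 / 12) / \<tau> - of_real (pi\<^sup>2 / (6 * t)) + of_real (pi\<^sup>2 / 12 * x\<^sup>2) / w
    = of_real (pi\<^sup>2 / 12) / (of_real t * w) * (w\<^sup>2 + 1 - 2 * w + of_real t * of_real x ^ 2)"
    unfolding \<tau> \<nu> using wnz tnz by (simp add: field_simps power2_eq_square)
  also have "\<dots> = 0" unfolding key by simp
  finally have id: "of_real \<nu> * \<tau> - of_real (pi\<^sup>2 / (6 * t)) + of_real (pi\<^sup>2 / 12 * x\<^sup>2) / w = - (of_real (pi\<^sup>2 / 12) / \<tau>)"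
    by (simp add: algebra_simps add_eq_0_iff2)
  have "of_real \<nu> * \<tau> + log_gf \<tau> - of_real (pi\<^sup>2 / (6 * t) - ln 2 / 2) + of_real (pi\<^sup>2 / 12 * x\<^sup>2) / w
    = (of_real \<nu> * \<tau> - of_real (pi\<^sup>2 / (6 * t)) + of_real (pi\<^sup>2 / 12 * x\<^sup>2) / w) + log_gf \<tau> + of_real (ln 2 / 2)"
    by simp
  also have "\<dots> = log_gf \<tau> - of_real (pi\<^sup>2 / 12) / \<tau> + of_real (ln 2 / 2)" unfolding id by simp
  also have "cmod \<dots> \<le> C * sqrt (cmod \<tau>)" using t Im_le by (intro C) (auto simp: Re)
  also have "\<dots> \<le> \<bar>C\<bar> * sqrt (cmod \<tau>)" by (intro mult_right_mono) auto
  also have "\<dots> \<le> \<bar>C\<bar> * sqrt (2 * t)" using norm\<tau> by (intro mult_left_mono) auto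
  finally show ?thesis unfolding w_def .
qed

text \<open>The left side is the scale times the value at the saddle point, over
  \<open>2 * pi\<close>, times the Gaussian integral. Both sides are positive, so it suffices to
  compare logarithms.\<close>

lemma saddle_constant:
  fixes n :: real
  assumes n: "n > 0" and t: "t = pi / (2 * sqrt (3 * n))"
  shows "t powr (3/2) * exp (pi\<^sup>2 / (6 * t) - ln 2 / 2) / (2 * pi) * sqrt (pi / (pi\<^sup>2 / 12))
    = exp (pi * sqrt (n / 3)) / (4 * 3 powr (1/4) * n powr (3/4))" (is "?L = ?R")
proof -
  have tpos: "t > 0" unfolding t using n by simp
  have e: "pi\<^sup>2 / (6 * t) = pi * sqrt (n / 3)"
  proof -
    have "pi\<^sup>2 / (6 * t) = pi * (sqrt (3 * n) / 3)" unfolding t by (simp add: power2_eq_square)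
    also have "sqrt (3 * n) / 3 = sqrt (n / 3)"
      by (rule real_sqrt_unique[symmetric]) (use n in \<open>auto simp: power_divide\<close>)
    finally show ?thesis .
  qed
  have l4: "ln (4::real) = 2 * ln 2"
    using ln_mult_pos[of 2 2] by simp
  have l12: "ln (12::real) = 2 * ln 2 + ln 3"
    using ln_mult_pos[of 4 3] l4 by simp
  have lt: "ln t = ln pi - ln 2 - (ln 3 + ln n) / 2"
    unfolding t using n by (simp add: ln_div ln_mult ln_sqrt)
  have "sqrt (pi / (pi\<^sup>2 / 12)) = sqrt (12 / pi)" by (simp add: power2_eq_square)
  hence "ln ?L = 3 / 2 * ln t + (pi * sqrt (n / 3) - ln 2 / 2) - ln (2 * pi) + (ln 12 - ln pi) / 2"
    unfolding e using tpos by (simp add: ln_mult ln_div ln_powr ln_sqrt)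
  also have "\<dots> = pi * sqrt (n / 3) - ln 4 - ln 3 / 4 - 3 / 4 * ln n"
    unfolding lt l12 l4 by (simp add: ln_mult field_simps)
  also have "\<dots> = ln ?R" using n by (simp add: ln_mult ln_div ln_powr)
  finally have "ln ?L = ln ?R" .
  moreover have "?L > 0" "?R > 0" using tpos n by auto
  ultimately show ?thesis by (simp only: ln_inj_iff)
qed

lemma distinct_parts_asymp:
  "(\<lambda>n. real (card (distinct_parts 0 n))) \<sim>[at_top] 
     (\<lambda>n. exp (pi * sqrt (real n / 3)) / (4 * 3 powr (1/4) * real n powr (3/4)))"
proof -
  obtain C where C: "\<And>\<tau>. Re \<tau> > 0 \<Longrightarrow> \<bar>Im \<tau>\<bar> \<le> Re \<tau> \<Longrightarrow>
     cmod (log_gf \<tau> - of_real (pi\<^sup>2 / 12) / \<tau> + of_real (ln 2 / 2)) \<le> C * sqrt (cmod \<tau>)"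
    using log_gf_asymp by blast
  \<comment> \<open>The saddle point: the positive solution of
    \<open>n = pi^2 / (12 * t^2)\<close>.\<close>
  define t where "t = (\<lambda>n::nat. pi / (2 * sqrt (3 * real n)))"
  define c where "c = (\<lambda>n. t n powr (3/2))"
  define M where "M = (\<lambda>n. exp (pi\<^sup>2 / (6 * t n) - ln 2 / 2))"
  define \<tau> where "\<tau> = (\<lambda>n x. Complex (t n) (x * c n))"
  \<comment> \<open>The integrand after the substitution \<open>\<theta> = c n * x\<close>, divided
    by its approximate size \<open>M n\<close> at the saddle point.\<close>
  define h where "h = (\<lambda>n x. indicator {-pi..pi} (x * c n) *\<^sub>R
     exp (of_nat n * \<tau> n x + log_gf (\<tau> n x) - of_real (pi\<^sup>2 / (6 * t n) - ln 2 / 2)))"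
  have tpos: "t n > 0" if "n > 0" for n unfolding t_def using that by simp
  have \<nu>: "real n = pi\<^sup>2 / (12 * (t n)\<^sup>2)" if "n > 0" for n
    using that unfolding t_def by (simp add: power_divide power_mult_distrib)
  have tlim: "t \<longlonglongrightarrow> 0" unfolding t_def by real_asymp
  have int: "(LINT x|lborel. h n x) = of_real (2 * pi * card (distinct_parts 0 n) / (c n * M n))" if n: "n > 0" for n
  proof -
    have cpos: "c n > 0" unfolding c_def using tpos[OF n] by simp
    have split: "exp A = of_real (exp B) * exp (A - of_real B)" for A :: complex and B
      by (simp add: exp_diff flip: exp_of_real)
    let ?f = "\<lambda>\<theta>. indicator {-pi..pi} \<theta> *\<^sub>R exp (of_nat n * Complex (t n) \<theta> + log_gf (Complex (t n) \<theta>))"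
    have "of_real (2 * pi * card (distinct_parts 0 n)) = (LINT \<theta>|lborel. ?f \<theta>)"
      by (rule card_distinct_parts_integral[symmetric, OF tpos[OF n]])
    also have "\<dots> = \<bar>c n\<bar> *\<^sub>R (LINT x|lborel. ?f (0 + c n * x))"
      using cpos by (intro lborel_integral_real_affine) simp
    also have "(LINT x|lborel. ?f (0 + c n * x)) = (LINT x|lborel. of_real (M n) * h n x)"
    proof (rule Bochner_Integration.integral_cong[OF refl])
      fix x
      show "?f (0 + c n * x) = of_real (M n) * h n x"
        unfolding h_def M_def \<tau>_def
        by (simp only: mult_scaleR_right split[symmetric] mult.commute[of "c n"] add_0_left)
    qed
    also have "\<dots> = of_real (M n) * (LINT x|lborel. h n x)" by simp
    finally have "of_real (2 * pi * card (distinct_parts 0 n)) = of_real (c n * M n) * (LINT x|lborel. h n x)"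
      using cpos by (simp add: scaleR_conv_of_real)
    moreover have "c n * M n \<noteq> 0" using cpos by (simp add: M_def)
    ultimately show ?thesis by (simp add: field_simps)
  qed
  \<comment> \<open>The majorant requires \<open>t N \<le> 1 / 2\<close>, that is,
    \<open>pi \<le> sqrt (3 * N)\<close>, which holds from \<open>N = 4\<close> on; hence the shift
    by 4.\<close>
  have "(\<lambda>n. LINT x|lborel. h (n + 4) x) \<longlonglongrightarrow> (LINT x|lborel. complex_of_real (exp (- (pi\<^sup>2 / 12) * x\<^sup>2)))"
  proof (rule integral_dominated_convergence[where w = "\<lambda>x. exp \<bar>C\<bar> * (3 * 10 ^ 8) * (1 / (1 + x\<^sup>2))"])
    show "(\<lambda>x. complex_of_real (exp (- (pi\<^sup>2 / 12) * x\<^sup>2))) \<in> borel_measurable lborel" by measurable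
    show "h (n + 4) \<in> borel_measurable lborel" for n unfolding h_def \<tau>_def by measurable
    show "integrable lborel (\<lambda>x::real. exp \<bar>C\<bar> * (3 * 10 ^ 8) * (1 / (1 + x\<^sup>2)))"
      by (intro integrable_mult_right integrable_inverse_one_plus_square)
    show "AE x in lborel. (\<lambda>n. h (n + 4) x) \<longlonglongrightarrow> complex_of_real (exp (- (pi\<^sup>2 / 12) * x\<^sup>2))"
    proof (rule AE_I2, rule LIMSEQ_ignore_initial_segment)
      fix x :: real
      define D where "D = (\<lambda>n. of_nat n * \<tau> n x + log_gf (\<tau> n x) - of_real (pi\<^sup>2 / (6 * t n) - ln 2 / 2))"
      define W where "W = (\<lambda>n. of_real (pi\<^sup>2 / 12 * x\<^sup>2) / (1 + \<i> * of_real (sqrt (t n) * x)))"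
      have sq: "(\<lambda>n. sqrt (t n)) \<longlonglongrightarrow> 0" using tendsto_real_sqrt[OF tlim] by simp
      have small: "(\<lambda>n. \<bar>x\<bar> * sqrt (t n)) \<longlonglongrightarrow> 0" by (intro tendsto_mult_right_zero sq)
      have cl: "(\<lambda>n. \<bar>x * c n\<bar>) \<longlonglongrightarrow> 0"
      proof -
        have "c \<longlonglongrightarrow> 0" unfolding c_def t_def by real_asymp
        thus ?thesis by (intro tendsto_rabs_zero tendsto_mult_right_zero)
      qed
      have ev1: "eventually (\<lambda>n. \<bar>x\<bar> * sqrt (t n) < 1) sequentially"
        by (rule order_tendstoD(2)[OF small]) simp
      have ev2: "eventually (\<lambda>n. \<bar>x * c n\<bar> < pi) sequentially"
        by (rule order_tendstoD(2)[OF cl]) simp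
      \<comment> \<open>\<open>D\<close> is the normalised exponent and \<open>- W\<close> its
        saddle point approximation; for fixed \<open>x\<close> the denominator in \<open>W\<close>
        tends to 1, leaving the Gaussian exponent.\<close>
      have "(\<lambda>n. D n + W n) \<longlonglongrightarrow> 0"
      proof (rule Lim_null_comparison)
        show "eventually (\<lambda>n. norm (D n + W n) \<le> \<bar>C\<bar> * sqrt (2 * t n)) sequentially"
          using ev1 eventually_gt_at_top[of 0]
        proof eventually_elim
          case (elim n)
          thus ?case
            using saddle_point_expansion[OF C tpos \<nu>, of n x] unfolding D_def W_def \<tau>_def c_def by simp
        qed
        have "(\<lambda>n. \<bar>C\<bar> * sqrt (2 * t n)) \<longlonglongrightarrow> \<bar>C\<bar> * sqrt (2 * 0)" by (intro tendsto_intros tlim)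
        thus "(\<lambda>n. \<bar>C\<bar> * sqrt (2 * t n)) \<longlonglongrightarrow> 0" by simp
      qed
      moreover have "W \<longlonglongrightarrow> of_real (pi\<^sup>2 / 12 * x\<^sup>2) / (1 + \<i> * of_real (0 * x))"
        unfolding W_def by (intro tendsto_intros sq) simp
      ultimately have "(\<lambda>n. (D n + W n) - W n) \<longlonglongrightarrow> 0 - of_real (pi\<^sup>2 / 12 * x\<^sup>2) / (1 + \<i> * of_real (0 * x))"
        by (intro tendsto_diff)
      hence "D \<longlonglongrightarrow> - of_real (pi\<^sup>2 / 12 * x\<^sup>2)" by simp
      hence "(\<lambda>n. exp (D n)) \<longlonglongrightarrow> exp (- of_real (pi\<^sup>2 / 12 * x\<^sup>2))" by (rule tendsto_exp)
      also have "exp (- of_real (pi\<^sup>2 / 12 * x\<^sup>2)) = complex_of_real (exp (- (pi\<^sup>2 / 12) * x\<^sup>2))"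
        by (simp flip: exp_of_real)
      finally show "(\<lambda>n. h n x) \<longlonglongrightarrow> complex_of_real (exp (- (pi\<^sup>2 / 12) * x\<^sup>2))"
      proof (rule Lim_transform_eventually)
        show "eventually (\<lambda>n. exp (D n) = h n x) sequentially"
          using ev2 by eventually_elim (auto simp: h_def D_def indicator_def)
      qed
    qed
    show "AE x in lborel. norm (h (n + 4) x) \<le> exp \<bar>C\<bar> * (3 * 10 ^ 8) * (1 / (1 + x\<^sup>2))" for n
    proof (rule AE_I2)
      fix x :: real
      define N where "N = n + 4"
      have N: "N > 0" unfolding N_def by simp
      note tp = tpos[OF N]
      have thalf: "t N \<le> 1 / 2"
      proof -
        have "pi\<^sup>2 \<le> 3.15\<^sup>2" using pi_approx by (intro power_mono) auto
        also have "\<dots> \<le> 3 * real N" unfolding N_def by (simp add: power2_eq_square)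
        finally have "pi \<le> sqrt (3 * real N)" by (rule real_le_rsqrt)
        thus ?thesis unfolding t_def using N by (simp add: field_simps)
      qed
      show "norm (h (n + 4) x) \<le> exp \<bar>C\<bar> * (3 * 10 ^ 8) * (1 / (1 + x\<^sup>2))"
      proof (cases "x * c N \<in> {-pi..pi}")
        case False
        thus ?thesis unfolding h_def N_def by (simp add: add_nonneg_nonneg)
      next
        case True
        have xc: "\<bar>x\<bar> * t N powr (3/2) \<le> pi" using True unfolding c_def by (auto simp: abs_mult abs_le_iff)
        define A where "A = pi\<^sup>2 / (6 * t N) - ln 2 / 2"
        have "norm (h N x) = exp (real N * t N) * cmod (exp (log_gf (\<tau> N x))) / exp A"
          using True unfolding h_def exp_diff exp_add norm_mult norm_divide A_def[symmetric]
          by (simp add: \<tau>_def norm_mult norm_divide)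
        also have "\<dots> \<le> exp (real N * t N) * (cmod (exp (log_gf (of_real (t N)))) * (3 * 10 ^ 8 / (1 + x\<^sup>2))) / exp A"
          unfolding \<tau>_def c_def
          by (intro divide_right_mono mult_left_mono norm_exp_log_gf_majorant[OF tp thalf xc]) auto
        also have "\<dots> = cmod (exp (of_real (real N) * of_real (t N) + log_gf (of_real (t N)) - of_real A)) * (3 * 10 ^ 8 * (1 / (1 + x\<^sup>2)))"
          unfolding exp_diff exp_add norm_mult norm_divide by (simp add: mult_ac)
        also have "\<dots> \<le> exp \<bar>C\<bar> * (3 * 10 ^ 8 * (1 / (1 + x\<^sup>2)))"
        proof (rule mult_right_mono)
          have t0: "Complex (t N) 0 = of_real (t N)" by (simp add: complex_eq_iff)
          \<comment> \<open>The expansion at \<open>x = 0\<close> controls the value at the real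
            point, where \<open>sqrt (2 * t N) \<le> 1\<close>; this is the origin of
            \<open>exp \<bar>C\<bar>\<close> in the majorant.\<close>
          have "cmod (of_real (real N) * of_real (t N) + log_gf (of_real (t N)) - of_real A) \<le> \<bar>C\<bar> * sqrt (2 * t N)"
            using saddle_point_expansion[OF C tp \<nu>[OF N], of 0] unfolding A_def by (simp add: t0)
          also have "\<dots> \<le> \<bar>C\<bar> * 1" using thalf by (intro mult_left_mono) auto
          finally have "cmod (of_real (real N) * of_real (t N) + log_gf (of_real (t N)) - of_real A) \<le> \<bar>C\<bar>" by simp
          thus "cmod (exp (of_real (real N) * of_real (t N) + log_gf (of_real (t N)) - of_real A)) \<le> exp \<bar>C\<bar>"
            using norm_exp[of "of_real (real N) * of_real (t N) + log_gf (of_real (t N)) - of_real A"]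
            by (meson exp_le_cancel_iff order_trans)
        qed (simp add: add_nonneg_nonneg)
        finally show ?thesis unfolding N_def by (simp only: mult.assoc)
      qed
    qed
  qed
  hence "(\<lambda>n. LINT x|lborel. h n x) \<longlonglongrightarrow> (LINT x|lborel. complex_of_real (exp (- (pi\<^sup>2 / 12) * x\<^sup>2)))"
    by (rule LIMSEQ_offset)
  also have "(LINT x|lborel. complex_of_real (exp (- (pi\<^sup>2 / 12) * x\<^sup>2))) = of_real (LINT x|lborel. exp (- (pi\<^sup>2 / 12) * x\<^sup>2))"
    by (rule integral_of_real, rule integral_gaussian) simp
  also have "(LINT x|lborel. exp (- (pi\<^sup>2 / 12) * x\<^sup>2)) = sqrt (pi / (pi\<^sup>2 / 12))"
    by (rule integral_gaussian) simp
  finally have "(\<lambda>n. LINT x|lborel. h n x) \<longlonglongrightarrow> of_real (sqrt (pi / (pi\<^sup>2 / 12)))" .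
  hence "(\<lambda>n. Re (LINT x|lborel. h n x)) \<longlonglongrightarrow> Re (of_real (sqrt (pi / (pi\<^sup>2 / 12))))" by (rule tendsto_Re)
  moreover have "eventually (\<lambda>n. Re (LINT x|lborel. h n x) = 2 * pi * card (distinct_parts 0 n) / (c n * M n)) sequentially"
    using eventually_gt_at_top[of 0] by eventually_elim (simp add: int del: of_real_divide of_real_mult)
  ultimately have "(\<lambda>n. 2 * pi * card (distinct_parts 0 n) / (c n * M n)) \<longlonglongrightarrow> sqrt (pi / (pi\<^sup>2 / 12))"
    by (simp add: Lim_transform_eventually)
  hence "(\<lambda>n. 2 * pi * card (distinct_parts 0 n) / (c n * M n) / sqrt (pi / (pi\<^sup>2 / 12))) \<longlonglongrightarrow> sqrt (pi / (pi\<^sup>2 / 12)) / sqrt (pi / (pi\<^sup>2 / 12))"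
    by (intro tendsto_divide tendsto_const) auto
  also have "sqrt (pi / (pi\<^sup>2 / 12)) / sqrt (pi / (pi\<^sup>2 / 12)) = 1" by simp
  finally have lim: "(\<lambda>n. 2 * pi * card (distinct_parts 0 n) / (c n * M n) / sqrt (pi / (pi\<^sup>2 / 12))) \<longlonglongrightarrow> 1" .
  show ?thesis
  proof (rule asymp_equivI', rule Lim_transform_eventually[OF lim])
    show "eventually (\<lambda>n. 2 * pi * card (distinct_parts 0 n) / (c n * M n) / sqrt (pi / (pi\<^sup>2 / 12)) =
       real (card (distinct_parts 0 n)) / (exp (pi * sqrt (real n / 3)) / (4 * 3 powr (1/4) * real n powr (3/4)))) at_top"
      using eventually_gt_at_top[of 0]
    proof eventually_elim
      case (elim n)
      have "exp (pi * sqrt (real n / 3)) / (4 * 3 powr (1/4) * real n powr (3/4)) = c n * M n / (2 * pi) * sqrt (pi / (pi\<^sup>2 / 12))"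
        using saddle_constant[of "real n" "t n"] elim unfolding c_def M_def t_def by simp
      thus ?case by (simp add: mult_ac)
    qed
  qed
qed

section \<open>From distinct parts to odd-even overpartitions\<close>

theorem theorem1p2:
  shows "(\<lambda>n::nat. real (OE n)) \<sim>[at_top]
    (\<lambda>n. 1 / (3 powr (5/4) * real n powr (3/4)) * exp (pi * sqrt (real n / 3)))"
proof -
  define g where "g = (\<lambda>n::nat. exp (pi * sqrt (real n / 3)) / (4 * 3 powr (1/4) * real n powr (3/4)))"
  define Q where "Q = (\<lambda>n. real (card (distinct_parts 0 n)))"
  have Qg: "Q \<sim>[at_top] g" unfolding Q_def g_def by (rule distinct_parts_asymp)
  have gpos: "eventually (\<lambda>n. g n > 0) at_top"
    using eventually_gt_at_top[of 0] by eventually_elim (simp add: g_def)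
  have Qpos: "eventually (\<lambda>n. Q n > 0) at_top"
    using asymp_equiv_eventually_pos_iff[OF Qg] gpos by eventually_elim simp
  have shift: "(\<lambda>n. Q (n + j) / Q n) \<longlonglongrightarrow> 1" for j
  proof -
    have "(\<lambda>n. Q (n + j)) \<sim>[at_top] (\<lambda>n. g (n + j))"
      by (rule asymp_equiv_compose'[OF Qg]) (rule filterlim_add_const_nat_at_top)
    \<comment> \<open>A fixed shift changes \<open>sqrt (n / 3)\<close> only by \<open>o(1)\<close>,
      and the power of \<open>n\<close> by a factor tending to 1.\<close>
    also have "(\<lambda>n. g (n + j)) \<sim>[at_top] g" unfolding g_def of_nat_add by real_asymp
    also have "g \<sim>[at_top] Q" using Qg by (rule asymp_equiv_symI)
    finally show ?thesis
      by (rule asymp_equivD_strong) (use Qpos in \<open>auto elim: eventually_mono\<close>)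
  qed
  have "(\<lambda>n. real (card (odd_min_parts n)) / Q n) \<longlonglongrightarrow> 2 / 3"
    unfolding Q_def by (rule odd_min_parts_ratio_limit[OF Qpos[unfolded Q_def] shift[unfolded Q_def]])
  hence "(\<lambda>n. real (card (odd_min_parts n))) \<sim>[at_top] (\<lambda>n. 2 / 3 * Q n)"
    by (rule asymp_equivI'_const) simp
  also have "(\<lambda>n. 2 / 3 * Q n) \<sim>[at_top] (\<lambda>n. 2 / 3 * g n)"
    by (intro asymp_equiv_intros Qg)
  finally have lim: "(\<lambda>n. 2 * real (card (odd_min_parts n))) \<sim>[at_top] (\<lambda>n. 2 * (2 / 3 * g n))"
    by (intro asymp_equiv_intros)
  have "eventually (\<lambda>n. real (OE n) = 2 * real (card (odd_min_parts n))) at_top"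
    using eventually_gt_at_top[of 0] by eventually_elim (simp add: OE_eq)
  hence "(\<lambda>n. real (OE n)) \<sim>[at_top] (\<lambda>n. 2 * real (card (odd_min_parts n)))"
    by (rule asymp_equiv_refl_ev)
  also note lim
  also have "(\<lambda>n. 2 * (2 / 3 * g n)) = (\<lambda>n. 1 / (3 powr (5/4) * real n powr (3/4)) * exp (pi * sqrt (real n / 3)))"
  proof
    fix n
    \<comment> \<open>The constants combine as \<open>2 * (2 / 3) / 4 = 1 / 3\<close>, and this 3
      joins \<open>3 powr (1/4)\<close>.\<close>
    have "(3::real) powr (5/4) = 3 * 3 powr (1/4)" using powr_add[of "3::real" 1 "1/4"] by simp
    thus "2 * (2 / 3 * g n) = 1 / (3 powr (5/4) * real n powr (3/4)) * exp (pi * sqrt (real n / 3))"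
      unfolding g_def by simp
  qed
  finally show ?thesis .
qed

end
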